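(* Let $B\subset A$ be an inclusion of simple unital $C^*$-algebras with a conditional expectation of index-finite type. Let $\varepsilon_{A'\cap A_2}(w)=\tau^{-1}\langle e_2,w\rangle$ and $\varepsilon^{\mathrm{NV}}_{A'\cap A_2}(w)=\langle1,w\rangle_{\mathrm{NV}}$ for $w\in A'\cap A_2$. Then $$\varepsilon^{\mathrm{NV}}_{A'\cap A_2}(w)=d\,\varepsilon_{A'\cap A_2}(w)\qquad\text{for all } w\in A'\cap A_2.$$
   Context: Setting: $B\subset A$ is a unital inclusion of simple unital $C^*$-algebras with a conditional expectation of index-finite type (i.e. one admitting a finite quasi-basis). $E_0:A\to B$ is the unique minimal conditional expectation, $[A:B]_0$ its (scalar) Watatani index and $\tau=[A:B]_0^{-1}$. Put $A_{-1}=B$, $A_0=A$. $B\subset A\subset A_1\subset A_2\subset\cdots$ is the tower of Watatani's $C^*$-basic constructions: $A_n$ is generated by $A_{n-1}$ and the Jones projection $e_n$, with $e_nxe_n=E_{n-1}(x)e_n$ for $x\in A_{n-1}$ and $e_n$ commuting with $A_{n-2}$; $E_n:A_n\to A_{n-1}$ is the dual (minimal) conditional expectation, with $E_n(xe_ny)=\tau xy$ for $x,y\in A_{n-1}$. $C'\cap D$ denotes the relative commutant; $B'\cap A_n$ is a finite-dimensional $C^*$-algebra. $\operatorname{tr}=E_0\circ\cdots\circ E_n$ restricted to $B'\cap A_n$ is a faithful tracial state, compatible with inclusions, and $\langle x,y\rangle=\operatorname{tr}(x^*y)$. NV pairing: $\langle x,w\rangle_{\mathrm{NV}}=d\,\tau^{-2}\operatorname{tr}(xe_2e_1w)$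 for $x\in B'\cap A_1$, $w\in A'\cap A_2$, where $d=\|\mathrm{Ind}_W(E_1|_{A'\cap A_1})\|_2>0$ is the $2$-norm ($\|x\|_2=\operatorname{tr}(x^*x)^{1/2}$) of the Watatani index of $E_1|_{A'\cap A_1}:A'\cap A_1\to\mathbb C$. *)

theory Defs
  imports "HOL-Analysis.Analysis"
begin

class unital_cstar_algebra = real_normed_algebra_1 + banach +
  fixes scaleC :: "complex \<Rightarrow> 'a \<Rightarrow> 'a"  (infixr "*\<^sub>C" 75)
    and star :: "'a \<Rightarrow> 'a"
  assumes scaleC_add_right: "c *\<^sub>C (x + y) = c *\<^sub>C x + c *\<^sub>C y"
    and scaleC_add_left: "(c + c') *\<^sub>C x = c *\<^sub>C x + c' *\<^sub>C x"
    and scaleC_scaleC: "c *\<^sub>C (c' *\<^sub>C x) = (c * c') *\<^sub>C x"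
    and scaleC_of_real: "complex_of_real r *\<^sub>C x = r *\<^sub>R x"
    and mult_scaleC_left: "(c *\<^sub>C x) * y = c *\<^sub>C (x * y)"
    and mult_scaleC_right: "x * (c *\<^sub>C y) = c *\<^sub>C (x * y)"
    and norm_scaleC: "norm (c *\<^sub>C x) = cmod c * norm x"
    and star_add: "star (x + y) = star x + star y"
    and star_scaleC: "star (c *\<^sub>C x) = cnj c *\<^sub>C star x"
    and star_mult: "star (x * y) = star y * star x"
    and star_star: "star (star x) = x"
    and cstar_identity: "norm (star x * x) = (norm x)\<^sup>2"

text \<open>All algebras of the tower are subalgebras, with common unit, of one ambient unital
  C*-algebra, the universe of the type; such an ambient algebra always exists, e.g.
  the last member of the part of the tower in use.\<close>

definition cstar_subalgebra :: "'a::unital_cstar_algebra set \<Rightarrow> bool" where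
  "cstar_subalgebra D \<longleftrightarrow> closed D \<and> 1 \<in> D \<and>
     (\<forall>x\<in>D. \<forall>y\<in>D. x + y \<in> D \<and> x * y \<in> D) \<and>
     (\<forall>c. \<forall>x\<in>D. c *\<^sub>C x \<in> D) \<and> (\<forall>x\<in>D. star x \<in> D)"

definition closed_ideal :: "'a::unital_cstar_algebra set \<Rightarrow> 'a set \<Rightarrow> bool" where
  "closed_ideal D I \<longleftrightarrow> I \<subseteq> D \<and> closed I \<and> 0 \<in> I \<and>
     (\<forall>x\<in>I. \<forall>y\<in>I. x + y \<in> I) \<and> (\<forall>c. \<forall>x\<in>I. c *\<^sub>C x \<in> I) \<and>
     (\<forall>a\<in>D. \<forall>x\<in>I. a * x \<in> I \<and> x * a \<in> I)"

definition simple_cstar :: "'a::unital_cstar_algebra set \<Rightarrow> bool" where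
  "simple_cstar D \<longleftrightarrow> cstar_subalgebra D \<and> (\<forall>I. closed_ideal D I \<longrightarrow> I = {0} \<or> I = D)"

definition commutant :: "'a::unital_cstar_algebra set \<Rightarrow> 'a set \<Rightarrow> 'a set" where
  "commutant C D = {x \<in> D. \<forall>c\<in>C. c * x = x * c}"

definition conditional_expectation ::
    "'a::unital_cstar_algebra set \<Rightarrow> 'a set \<Rightarrow> ('a \<Rightarrow> 'a) \<Rightarrow> bool" where
  "conditional_expectation B A E \<longleftrightarrow>
     (\<forall>x\<in>A. E x \<in> B) \<and>
     (\<forall>x\<in>A. \<forall>y\<in>A. E (x + y) = E x + E y) \<and>
     (\<forall>c. \<forall>x\<in>A. E (c *\<^sub>C x) = c *\<^sub>C E x) \<and>
     (\<forall>b\<in>B. E b = b) \<and>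
     (\<forall>b\<in>B. \<forall>x\<in>A. E (b * x) = b * E x \<and> E (x * b) = E x * b) \<and>
     (\<forall>x\<in>A. \<exists>b\<in>B. E (star x * x) = star b * b)"

definition quasi_basis ::
    "'a::unital_cstar_algebra set \<Rightarrow> ('a \<Rightarrow> 'a) \<Rightarrow> nat \<Rightarrow> (nat \<Rightarrow> 'a) \<Rightarrow> (nat \<Rightarrow> 'a) \<Rightarrow> bool" where
  "quasi_basis A E n u v \<longleftrightarrow>
     (\<forall>i<n. u i \<in> A \<and> v i \<in> A) \<and>
     (\<forall>x\<in>A. x = (\<Sum>i<n. u i * E (v i * x)) \<and> x = (\<Sum>i<n. E (x * u i) * v i))"

definition index_finite_type ::
    "'a::unital_cstar_algebra set \<Rightarrow> 'a set \<Rightarrow> ('a \<Rightarrow> 'a) \<Rightarrow> bool" where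
  "index_finite_type B A E \<longleftrightarrow> conditional_expectation B A E \<and> (\<exists>n u v. quasi_basis A E n u v)"

text \<open>The value does not depend on the quasi-basis, so the description below is proper for
  every conditional expectation of index-finite type on \<open>A\<close>.\<close>

definition watatani_index :: "'a::unital_cstar_algebra set \<Rightarrow> ('a \<Rightarrow> 'a) \<Rightarrow> 'a" where
  "watatani_index A E = (THE z. \<exists>n u v. quasi_basis A E n u v \<and> z = (\<Sum>i<n. u i * v i))"

text \<open>The index is self-adjoint and central in \<open>A\<close>, hence a real multiple of \<open>1\<close> when \<open>A\<close> is
  simple.\<close>

definition scalar_index :: "'a::unital_cstar_algebra set \<Rightarrow> ('a \<Rightarrow> 'a) \<Rightarrow> real" where
  "scalar_index A E = (THE r. watatani_index A E = of_real r)"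

definition minimal_conditional_expectation ::
    "'a::unital_cstar_algebra set \<Rightarrow> 'a set \<Rightarrow> ('a \<Rightarrow> 'a) \<Rightarrow> bool" where
  "minimal_conditional_expectation B A E \<longleftrightarrow> index_finite_type B A E \<and>
     (\<forall>F. index_finite_type B A F \<longrightarrow> scalar_index A E \<le> scalar_index A F)"

text \<open>\<open>A\<close> is regarded as the right Hilbert \<open>B\<close>-module with inner product \<open>E (star x * y)\<close>
  (complete, as \<open>E\<close> has index-finite type); \<open>\<pi>\<close> is an injective *-homomorphism from \<open>C\<close>
  into its adjointable operators.\<close>

definition faithful_module_rep ::
    "'a::unital_cstar_algebra set \<Rightarrow> ('a \<Rightarrow> 'a) \<Rightarrow> 'a set \<Rightarrow> ('a \<Rightarrow> 'a \<Rightarrow> 'a) \<Rightarrow> bool" where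
  "faithful_module_rep A E C \<pi> \<longleftrightarrow>
     (\<forall>z\<in>C. \<forall>x\<in>A. \<pi> z x \<in> A) \<and>
     (\<forall>z\<in>C. \<forall>x\<in>A. \<forall>y\<in>A. E (star (\<pi> z x) * y) = E (star x * \<pi> (star z) y)) \<and>
     (\<forall>z\<in>C. \<forall>w\<in>C. \<forall>x\<in>A. \<pi> (z + w) x = \<pi> z x + \<pi> w x \<and> \<pi> (z * w) x = \<pi> z (\<pi> w x)) \<and>
     (\<forall>c. \<forall>z\<in>C. \<forall>x\<in>A. \<pi> (c *\<^sub>C z) x = c *\<^sub>C \<pi> z x) \<and>
     (\<forall>z\<in>C. (\<forall>x\<in>A. \<pi> z x = 0) \<longrightarrow> z = 0)"

text \<open>Watatani's C*-basic construction of \<open>E : A \<rightarrow> B\<close> is the closed linear span of the operators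
  \<open>\<lambda>(x) e\<^sub>B \<lambda>(y)\<close>, where \<open>\<lambda>\<close> is left multiplication and \<open>e\<^sub>B\<close> is \<open>E\<close> itself, acting on the above
  module.  Since injective *-homomorphisms are isometric, the predicate says that \<open>C\<close> is this
  algebra up to an isomorphism that identifies \<open>a \<in> A\<close> with \<open>\<lambda>(a)\<close> and \<open>e\<close> with the Jones
  projection.  Scalars are absorbed in the coefficients of the span.\<close>

definition basic_construction ::
    "'a::unital_cstar_algebra set \<Rightarrow> ('a \<Rightarrow> 'a) \<Rightarrow> 'a \<Rightarrow> 'a set \<Rightarrow> bool" where
  "basic_construction A E e C \<longleftrightarrow>
     cstar_subalgebra C \<and> A \<subseteq> C \<and> e \<in> C \<and>
     C = closure {z. \<exists>n x y. (\<forall>i<n::nat. x i \<in> A \<and> y i \<in> A) \<and> z = (\<Sum>i<n. x i * e * y i)} \<and>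
     (\<exists>\<pi>. faithful_module_rep A E C \<pi> \<and>
          (\<forall>a\<in>A. \<forall>x\<in>A. \<pi> a x = a * x) \<and> (\<forall>x\<in>A. \<pi> e x = E x))"

definition dual_conditional_expectation ::
    "'a::unital_cstar_algebra set \<Rightarrow> 'a \<Rightarrow> 'a set \<Rightarrow> real \<Rightarrow> ('a \<Rightarrow> 'a) \<Rightarrow> bool" where
  "dual_conditional_expectation A e C \<tau> F \<longleftrightarrow> conditional_expectation A C F \<and>
     (\<forall>x\<in>A. \<forall>y\<in>A. F (x * e * y) = \<tau> *\<^sub>R (x * y))"

definition scalar_of :: "'a::unital_cstar_algebra \<Rightarrow> complex" where
  "scalar_of x = (THE c. x = c *\<^sub>C 1)"

text \<open>On \<open>B' \<inter> A\<^sub>2\<close> the composite is scalar because \<open>B' \<inter> B\<close> is.  On \<open>B' \<inter> A\<^sub>1\<close>, where \<open>E\<^sub>2\<close> is the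
  identity, the value is that of \<open>E\<^sub>0 \<circ> E\<^sub>1\<close>.\<close>

definition tower_trace ::
    "('a \<Rightarrow> 'a) \<Rightarrow> ('a \<Rightarrow> 'a) \<Rightarrow> ('a \<Rightarrow> 'a) \<Rightarrow> 'a::unital_cstar_algebra \<Rightarrow> complex" where
  "tower_trace E0 E1 E2 x = scalar_of (E0 (E1 (E2 x)))"

definition trace_inner :: "('a \<Rightarrow> complex) \<Rightarrow> 'a::unital_cstar_algebra \<Rightarrow> 'a \<Rightarrow> complex" where
  "trace_inner tr x y = tr (star x * y)"

definition two_norm :: "('a \<Rightarrow> complex) \<Rightarrow> 'a::unital_cstar_algebra \<Rightarrow> real" where
  "two_norm tr x = sqrt (Re (tr (star x * x)))"

definition nv_pairing ::
    "real \<Rightarrow> real \<Rightarrow> 'a \<Rightarrow> 'a \<Rightarrow> ('a \<Rightarrow> complex) \<Rightarrow> 'a::unital_cstar_algebra \<Rightarrow> 'a \<Rightarrow> complex" where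
  "nv_pairing d \<tau> e1 e2 tr x w = of_real (d / \<tau>\<^sup>2) * tr (x * e2 * e1 * w)"

end

theory Submission
  imports Defs
begin

text \<open>
  The claim reduces to \<open>tr(e\<^sub>2 e\<^sub>1 w) = \<tau> tr(e\<^sub>2 w)\<close> for \<open>w \<in> A' \<inter> A\<^sub>2\<close>, since \<open>d\<close> is a common
  factor.  On the conceptual level this holds because the trace-preserving expectation of
  \<open>B' \<inter> A\<^sub>2\<close> onto \<open>A' \<inter> A\<^sub>2\<close> sends \<open>e\<^sub>1\<close> to \<open>\<tau>\<close>.  The proof below makes that explicit, by moving
  the element \<open>w\<close> down the tower.

  In a basic construction \<open>B \<subseteq> A \<subseteq> C\<close> with Jones projection \<open>e\<close>, every \<open>w \<in> C\<close> satisfies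
  \<open>w e = t e\<close> for a unique \<open>t \<in> A\<close> (think of \<open>w\<close> as an operator on the module \<open>A\<close> and of \<open>t\<close> as
  its value at \<open>1\<close>); if \<open>w\<close> commutes with \<open>B\<close>, so does \<open>t\<close>.  With the dual expectation \<open>F\<close> one gets
  \<open>E(F(e x w)) = \<tau> E(x t)\<close> for \<open>x \<in> A\<close> (\<open>basic_construction_symbol\<close>).  Two applications
  give \<open>t \<in> A' \<inter> A\<^sub>1\<close> from \<open>w\<close> and \<open>s \<in> B' \<inter> A\<close> from \<open>t\<close>, and
  \<open>tr(e\<^sub>2 e\<^sub>1 w) = \<tau> E\<^sub>0(E\<^sub>1(e\<^sub>1 t)) = \<tau>\<^sup>2 E\<^sub>0(s)\<close>, whereas
  \<open>tr(e\<^sub>2 w) = \<tau> E\<^sub>0(E\<^sub>1(t)) = \<tau>\<^sup>2 \<theta>(s)\<close> with \<open>\<theta>(s) = \<Sum>i. u\<^sub>i s v\<^sub>i\<close> for a quasi-basis \<open>(u, v)\<close> of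
  \<open>E\<^sub>0\<close> (\<open>dual_expectation_of_symbol\<close>).  What remains is the identity
  \<open>\<theta>(s) = [A:B]\<^sub>0 E\<^sub>0(s)\<close> on \<open>B' \<inter> A\<close> (\<open>minimal_index_map\<close>), and it is here that minimality
  enters.

  That identity is the Euler-Lagrange equation of the minimisation problem.  If \<open>g \<in> B' \<inter> A\<close> is
  invertible, \<open>x \<mapsto> E\<^sub>0(g* x g) / E\<^sub>0(g* g)\<close> is again a conditional expectation of index-finite type,
  of index \<open>E\<^sub>0(g* g) \<theta>((g* g)\<^sup>-\<^sup>1)\<close>.  For \<open>g = 1 - \<epsilon> k\<close> with \<open>E\<^sub>0(k) = 0\<close> the first factor is
  \<open>1 + O(\<epsilon>\<^sup>2)\<close> and the second is \<open>\<theta>(1) + 2 \<epsilon> Re \<theta>(k) + O(\<epsilon>\<^sup>2)\<close>; minimality at \<open>\<epsilon> = 0\<close> forces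
  \<open>Re \<theta>(k) = 0\<close>, and \<open>\<i> k\<close> in place of \<open>k\<close> gives \<open>\<theta>(k) = 0\<close>.

  All this uses that \<open>E\<^sub>0\<close> and \<open>\<theta>\<close> are scalar on \<open>B' \<inter> A\<close>.  Their values are central in \<open>B\<close> and \<open>A\<close>, so
  one needs that simple C*-algebras have trivial centre (\<open>simple_cstar_center\<close>).  This rests on
  the nonemptiness of the spectrum of a normal element, for which there is an elementary
  argument that averages the resolvent over roots of unity instead of using Liouville's theorem.
\<close>

section \<open>Arithmetic in unital C*-algebras\<close>

lemma scaleC_one [simp]: "1 *\<^sub>C (x::'a::unital_cstar_algebra) = x"
  using scaleC_of_real[of 1 x] by simp

lemma scaleC_zero_left [simp]: "0 *\<^sub>C (x::'a::unital_cstar_algebra) = 0"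
  using scaleC_of_real[of 0 x] by simp

lemma scaleC_zero_right [simp]: "c *\<^sub>C (0::'a::unital_cstar_algebra) = 0"
  using scaleC_add_right[of c 0 0] by simp

lemma scaleC_minus_right: "c *\<^sub>C (- x) = - (c *\<^sub>C (x::'a::unital_cstar_algebra))"
  using scaleC_add_right[of c x "- x"] by (simp add: eq_neg_iff_add_eq_0 add.commute)

lemma scaleC_minus_left: "(- c) *\<^sub>C x = - (c *\<^sub>C (x::'a::unital_cstar_algebra))"
  using scaleC_add_left[of c "- c" x] by (simp add: eq_neg_iff_add_eq_0 add.commute)

lemma scaleC_minus_one: "(-1) *\<^sub>C x = - (x::'a::unital_cstar_algebra)"
  by (simp add: scaleC_minus_left)

lemma scaleC_diff_right: "c *\<^sub>C (x - y) = c *\<^sub>C x - c *\<^sub>C (y::'a::unital_cstar_algebra)"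
  using scaleC_add_right[of c x "- y"] by (simp add: scaleC_minus_right)

lemma scaleC_diff_left: "(c - c') *\<^sub>C x = c *\<^sub>C x - c' *\<^sub>C (x::'a::unital_cstar_algebra)"
  using scaleC_add_left[of c "- c'" x] by (simp add: scaleC_minus_left)

lemma scaleC_sum_right: "c *\<^sub>C (\<Sum>i\<in>I. f i) = (\<Sum>i\<in>I. c *\<^sub>C (f i :: 'a::unital_cstar_algebra))"
  by (induction I rule: infinite_finite_induct) (auto simp: scaleC_add_right)

lemma scaleC_one_inject:
  "c *\<^sub>C (1::'a::unital_cstar_algebra) = c' *\<^sub>C 1 \<longleftrightarrow> c = c'"
proof
  assume "c *\<^sub>C (1::'a) = c' *\<^sub>C 1"
  hence "norm ((c - c') *\<^sub>C (1::'a)) = 0" by (simp add: scaleC_diff_left)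
  thus "c = c'" by (simp add: norm_scaleC)
qed auto

lemma scalar_of_scaleC_one [simp]: "scalar_of (c *\<^sub>C (1::'a::unital_cstar_algebra)) = c"
  unfolding scalar_of_def by (simp add: scaleC_one_inject)

lemma scaleC_left_cancel:
  assumes "c \<noteq> 0" "c *\<^sub>C x = c *\<^sub>C (y::'a::unital_cstar_algebra)"
  shows "x = y"
proof -
  have "(inverse c) *\<^sub>C c *\<^sub>C x = (inverse c) *\<^sub>C c *\<^sub>C y" using assms by simp
  thus ?thesis using assms(1) by (simp add: scaleC_scaleC)
qed

lemma star_zero [simp]: "star (0::'a::unital_cstar_algebra) = 0"
  using star_add[of "0::'a" 0] by simp

lemma star_one [simp]: "star (1::'a::unital_cstar_algebra) = 1"
  by (metis mult_1 mult_1_right star_mult star_star)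

lemma star_minus: "star (- x) = - star (x::'a::unital_cstar_algebra)"
  using star_add[of x "- x"] by (simp add: eq_neg_iff_add_eq_0 add.commute)

lemma star_diff: "star (x - y) = star x - star (y::'a::unital_cstar_algebra)"
  using star_add[of x "- y"] by (simp add: star_minus)

lemma star_sum: "star (\<Sum>i\<in>I. f i) = (\<Sum>i\<in>I. star (f i :: 'a::unital_cstar_algebra))"
  by (induction I rule: infinite_finite_induct) (auto simp: star_add)

lemma norm_star [simp]: "norm (star x) = norm (x::'a::unital_cstar_algebra)"
proof -
  have le: "norm y \<le> norm (star y)" for y :: 'a
  proof (cases "y = 0")
    case False
    have "norm y * norm y \<le> norm (star y) * norm y"
      using cstar_identity[of y] norm_mult_ineq[of "star y" y] by (simp add: power2_eq_square)
    thus ?thesis using False by simp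
  qed simp
  show ?thesis using le[of x] le[of "star x"] by (simp add: star_star)
qed

lemma cstar_subalgebraD:
  assumes "cstar_subalgebra D"
  shows "closed D" "1 \<in> D" "\<And>x y. x \<in> D \<Longrightarrow> y \<in> D \<Longrightarrow> x + y \<in> D"
    "\<And>x y. x \<in> D \<Longrightarrow> y \<in> D \<Longrightarrow> x * y \<in> D" "\<And>c x. x \<in> D \<Longrightarrow> c *\<^sub>C x \<in> D"
    "\<And>x. x \<in> D \<Longrightarrow> star x \<in> D"
  using assms unfolding cstar_subalgebra_def by auto

lemma cstar_subalgebra_zero: "cstar_subalgebra D \<Longrightarrow> 0 \<in> D"
  using cstar_subalgebraD(5)[of D 1 0] cstar_subalgebraD(2)[of D] by simp

lemma cstar_subalgebra_minus: "cstar_subalgebra D \<Longrightarrow> x \<in> D \<Longrightarrow> - x \<in> D"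
  using cstar_subalgebraD(5)[of D x "-1"] by (simp add: scaleC_minus_one)

lemma cstar_subalgebra_diff: "cstar_subalgebra D \<Longrightarrow> x \<in> D \<Longrightarrow> y \<in> D \<Longrightarrow> x - y \<in> D"
  using cstar_subalgebraD(3)[of D x "- y"] cstar_subalgebra_minus[of D y] by simp

lemma cstar_subalgebra_sum:
  "cstar_subalgebra D \<Longrightarrow> (\<And>i. i \<in> I \<Longrightarrow> f i \<in> D) \<Longrightarrow> (\<Sum>i\<in>I. f i) \<in> D"
  by (induction I rule: infinite_finite_induct)
    (auto simp: cstar_subalgebra_zero cstar_subalgebraD(3))

lemma cstar_subalgebra_power: "cstar_subalgebra D \<Longrightarrow> x \<in> D \<Longrightarrow> x ^ n \<in> D"
  by (induction n) (auto intro: cstar_subalgebraD)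

lemma cstar_subalgebra_commutant:
  assumes D: "cstar_subalgebra D" and C: "\<And>c. c \<in> C \<Longrightarrow> star c \<in> C"
  shows "cstar_subalgebra (commutant C D)"
proof -
  have "commutant C D = D \<inter> (\<Inter>c\<in>C. {x. c * x = x * c})"
    unfolding commutant_def by auto
  moreover have "closed {x. c * x = x * c}" for c :: 'a
    by (intro closed_Collect_eq continuous_intros)
  ultimately have cl: "closed (commutant C D)"
    using cstar_subalgebraD(1)[OF D] by (simp add: closed_Int closed_INT)
  have st: "c * star x = star x * c" if "\<forall>c\<in>C. c * x = x * c" "c \<in> C" for x c
  proof -
    have "star (star c * x) = star (x * star c)" using that C by auto
    thus ?thesis by (simp add: star_mult star_star)
  qed
  have ml: "c * (x * y) = x * y * c" if "c * x = x * c" "c * y = y * c" for c x y :: 'a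
    by (metis mult.assoc that)
  show ?thesis
    unfolding cstar_subalgebra_def
    using cl cstar_subalgebraD[OF D] st ml
    by (auto simp: commutant_def distrib_left distrib_right mult_scaleC_left mult_scaleC_right)
qed

section \<open>The centre of a simple C*-algebra\<close>

text \<open>The inverse is the sum of the geometric series, which stays in every closed subalgebra that contains \<open>x\<close>.\<close>

lemma neumann_inverse:
  fixes x :: "'a::unital_cstar_algebra"
  assumes "norm x < 1"
  obtains y where "(1 - x) * y = 1" "y * (1 - x) = 1"
    "\<And>D. cstar_subalgebra D \<Longrightarrow> x \<in> D \<Longrightarrow> y \<in> D"
proof -
  have s: "summable (\<lambda>n. x ^ n)" using complete_algebra_summable_geometric[OF assms] .
  define y where "y = (\<Sum>n. x ^ n)"
  have "(\<Sum>n. x ^ Suc n) = y - 1"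
    using suminf_split_head[OF s] by (simp add: y_def)
  moreover have "(\<Sum>n. x ^ Suc n) = x * y"
    using suminf_mult[OF s, of x] by (simp add: y_def)
  moreover have "(\<Sum>n. x ^ Suc n) = y * x"
    using suminf_mult2[OF s, of x] by (simp add: y_def power_commutes)
  ultimately have "(1 - x) * y = 1" "y * (1 - x) = 1"
    by (simp_all add: algebra_simps)
  moreover have "y \<in> D" if D: "cstar_subalgebra D" "x \<in> D" for D
  proof (rule closed_sequentially[OF cstar_subalgebraD(1)[OF D(1)]])
    show "(\<lambda>n. \<Sum>i<n. x ^ i) \<longlonglongrightarrow> y" unfolding y_def using summable_LIMSEQ[OF s] .
    show "(\<Sum>i<n. x ^ i) \<in> D" for n
      by (intro cstar_subalgebra_sum[OF D(1)] cstar_subalgebra_power[OF D])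
  qed
  ultimately show ?thesis using that by blast
qed

text \<open>The C*-identity gives \<open>\<parallel>x\<^sup>2\<parallel> = \<parallel>x\<parallel>\<^sup>2\<close> for normal \<open>x\<close>; repeated squaring then shows that the
  norm of a normal element is its spectral radius, in the only form needed here.\<close>

lemma normal_power_norm:
  fixes z :: "'a::unital_cstar_algebra"
  assumes "star z * z = z * star z"
  shows "norm (z ^ 2 ^ k) = norm z ^ 2 ^ k \<and>
    star (z ^ 2 ^ k) * z ^ 2 ^ k = z ^ 2 ^ k * star (z ^ 2 ^ k)"
proof (induction k)
  case (Suc k)
  define x where "x = z ^ 2 ^ k"
  have x2: "z ^ 2 ^ Suc k = x * x"
    unfolding x_def by (simp flip: power_add add: mult_2)
  have c: "star x * x = x * star x" using Suc unfolding x_def by simp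
  have c': "star x * (x * y) = x * (star x * y)" for y
    using c by (simp flip: mult.assoc)
  have e: "star (x * x) * (x * x) = star (star x * x) * (star x * x)"
    by (simp add: star_mult star_star mult.assoc c c')
  have "(norm (x * x))\<^sup>2 = ((norm x)\<^sup>2)\<^sup>2"
    using cstar_identity[of "x * x"] cstar_identity[of "star x * x"] cstar_identity[of x] e by simp
  hence "norm (x * x) = (norm x)\<^sup>2" by (rule power2_eq_imp_eq) auto
  moreover have "star (x * x) * (x * x) = (x * x) * star (x * x)"
    by (simp add: star_mult mult.assoc c c')
  ultimately show ?case
    unfolding x2 using Suc by (simp add: x_def power2_eq_square mult_2 power_add)
qed (use assms in simp)

text \<open>The resolvent identity \<open>S m - S m\<^sub>0 = (m - m\<^sub>0) S m z S m\<^sub>0\<close> bounds \<open>\<parallel>S m - S m\<^sub>0\<parallel>\<close> in terms of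
  \<open>\<parallel>S m\<parallel> \<le> \<parallel>S m - S m\<^sub>0\<parallel> + \<parallel>S m\<^sub>0\<parallel>\<close>; for \<open>m\<close> near \<open>m\<^sub>0\<close> the first summand can be absorbed
  into the left-hand side.\<close>

lemma resolvent_continuous:
  fixes z :: "'a::unital_cstar_algebra"
  assumes S: "\<And>m. S m * (1 - m *\<^sub>C z) = 1" "\<And>m. (1 - m *\<^sub>C z) * S m = 1"
  shows "continuous_on UNIV S"
proof -
  have "isCont S m0" for m0
  proof -
    define K where "K = norm z * norm (S m0)"
    have K0: "K \<ge> 0" unfolding K_def by simp
    have bd: "norm (S m - S m0) \<le> 2 * (norm (m - m0) * K) * norm (S m0)"
      if h: "norm (m - m0) * K < 1/2" for m
    proof -
      have "S m - S m0 = S m * ((1 - m0 *\<^sub>C z) - (1 - m *\<^sub>C z)) * S m0"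
      proof -
        have "S m * ((1 - m0 *\<^sub>C z) - (1 - m *\<^sub>C z)) * S m0
          = S m * ((1 - m0 *\<^sub>C z) * S m0) - (S m * (1 - m *\<^sub>C z)) * S m0"
          by (simp only: right_diff_distrib left_diff_distrib mult.assoc)
        thus ?thesis using S by simp
      qed
      also have "(1 - m0 *\<^sub>C z) - (1 - m *\<^sub>C z) = (m - m0) *\<^sub>C z"
        by (simp add: scaleC_diff_left)
      finally have eq: "S m - S m0 = S m * ((m - m0) *\<^sub>C z) * S m0" .
      define q where "q = norm (S m - S m0)"
      have "q \<le> norm (S m) * norm ((m - m0) *\<^sub>C z) * norm (S m0)"
        unfolding q_def eq
        by (meson mult_right_mono norm_ge_zero norm_mult_ineq order_trans)
      also have "\<dots> = norm (S m) * (norm (m - m0) * K)"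
        by (simp add: norm_scaleC K_def)
      also have "\<dots> \<le> (q + norm (S m0)) * (norm (m - m0) * K)"
        using norm_triangle_ineq[of "S m - S m0" "S m0"] K0
        by (intro mult_right_mono) (auto simp: q_def)
      also have "\<dots> \<le> q / 2 + norm (S m0) * (norm (m - m0) * K)"
        using mult_left_mono[of "norm (m - m0) * K" "1/2" q] h
        by (simp add: distrib_right q_def)
      finally show ?thesis unfolding q_def by (simp add: field_simps)
    qed
    have t0: "((\<lambda>m. norm (m - m0) * K) \<longlongrightarrow> 0) (at m0)"
      by (auto intro!: tendsto_eq_intros)
    have "((\<lambda>m. S m - S m0) \<longlongrightarrow> 0) (at m0)"
    proof (rule Lim_null_comparison)
      show "\<forall>\<^sub>F m in at m0. norm (S m - S m0) \<le> 2 * (norm (m - m0) * K) * norm (S m0)"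
        using order_tendstoD(2)[OF t0, of "1/2"] bd by (auto elim!: eventually_mono)
      show "((\<lambda>m. 2 * (norm (m - m0) * K) * norm (S m0)) \<longlongrightarrow> 0) (at m0)"
        by (auto intro!: tendsto_eq_intros)
    qed
    thus ?thesis unfolding isCont_def using Lim_null by blast
  qed
  thus ?thesis by (simp add: continuous_on_eq_continuous_at)
qed

lemma unimodular_root_minus_one: "\<exists>c::complex. cmod c = 1 \<and> c ^ (2 ^ k) = -1"
proof (intro exI conjI)
  show "cmod (cis (pi / 2 ^ k)) = 1" by simp
  show "cis (pi / 2 ^ k) ^ (2 ^ k) = -1" by (simp only: Complex.DeMoivre) simp
qed

lemma scaleC_power: "(c *\<^sub>C x) ^ n = (c ^ n) *\<^sub>C ((x::'a::unital_cstar_algebra) ^ n)"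
  by (induction n) (auto simp: mult_scaleC_left mult_scaleC_right scaleC_scaleC mult.commute)

text \<open>Suppose that \<open>1 - m z\<close> were invertible for all \<open>m\<close>.  Averaging \<open>(1 - m z)\<^sup>-\<^sup>1\<close> over \<open>2\<^sup>k\<close>-th roots
  of unity yields \<open>T(m) = (1 - (m z)\<^sup>N)\<^sup>-\<^sup>1\<close> with \<open>N = 2\<^sup>k\<close>; the average is taken one squaring at a
  time, by \<open>(1 - a\<^sup>2)\<^sup>-\<^sup>1 = ((1 - a)\<^sup>-\<^sup>1 + (1 + a)\<^sup>-\<^sup>1) / 2\<close>.  Averages inherit the modulus of continuity
  of the resolvent, so \<open>T(1)\<close> is close to \<open>T(s)\<close> for some fixed \<open>s < 1\<close>, uniformly in \<open>k\<close>.  But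
  \<open>T(s)\<close> tends to \<open>1\<close> as \<open>k\<close> grows, whereas \<open>T(1)\<close> stays away from \<open>1\<close> because
  \<open>\<parallel>z\<^sup>N\<parallel> = 1\<close>.\<close>

lemma normal_resolvent_not_entire:
  fixes z :: "'a::unital_cstar_algebra"
  assumes normal: "star z * z = z * star z" and nz: "norm z = 1"
    and inv: "\<And>m. \<exists>y. y * (1 - m *\<^sub>C z) = 1 \<and> (1 - m *\<^sub>C z) * y = 1"
  shows False
proof -
  define S where "S m = (SOME y. y * (1 - m *\<^sub>C z) = 1 \<and> (1 - m *\<^sub>C z) * y = 1)" for m
  have S: "S m * (1 - m *\<^sub>C z) = 1" "(1 - m *\<^sub>C z) * S m = 1" for m
    using someI_ex[OF inv[of m]] by (auto simp: S_def)
  have "uniformly_continuous_on (cball 0 1) S"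
    by (intro compact_uniformly_continuous compact_cball
      continuous_on_subset[OF resolvent_continuous[of S z, OF S] subset_UNIV])
  then obtain \<delta> where \<delta>0: "\<delta> > 0" and "\<forall>x\<in>cball 0 1. \<forall>x'\<in>cball 0 1. dist x' x < \<delta> \<longrightarrow> dist (S x') (S x) < 1/8"
    unfolding uniformly_continuous_on_def by (meson zero_less_divide_1_iff zero_less_numeral)
  hence \<delta>: "dist (S m) (S m') < 1/8"
    if "cmod m \<le> 1" "cmod m' \<le> 1" "dist m m' < \<delta>" for m m' using that by simp
  define s where "s = 1 - min (1/2) (\<delta>/2)"
  have s: "0 < s" "s < 1" "1 - s < \<delta>" using \<delta>0 unfolding s_def by (auto simp: min_def)
  have ex: "\<exists>T. (\<forall>m. T m * (1 - (m *\<^sub>C z) ^ (2^k)) = 1 \<and> (1 - (m *\<^sub>C z) ^ (2^k)) * T m = 1) \<and>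
          (\<forall>m. cmod m = 1 \<longrightarrow> norm (T m - T (of_real s * m)) \<le> 1/8)" for k
  proof (induction k)
    case 0
    have "norm (S m - S (of_real s * m)) \<le> 1/8" if "cmod m = 1" for m
    proof -
      have "dist m (of_real s * m) = cmod (of_real (1 - s) * m)"
        by (simp add: dist_norm algebra_simps)
      also have "\<dots> = 1 - s" using s that by (simp only: norm_mult norm_of_real) simp
      finally have "dist m (of_real s * m) < \<delta>" using s by simp
      hence "dist (S m) (S (of_real s * m)) < 1/8" using s that by (intro \<delta>) (auto simp: norm_mult)
      thus ?thesis by (simp add: dist_norm)
    qed
    thus ?case using S by (intro exI[of _ S]) simp
  next
    case (Suc k)
    then obtain T where T: "\<And>m. T m * (1 - (m *\<^sub>C z) ^ (2^k)) = 1"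
       "\<And>m. (1 - (m *\<^sub>C z) ^ (2^k)) * T m = 1"
       "\<And>m. cmod m = 1 \<Longrightarrow> norm (T m - T (of_real s * m)) \<le> 1/8" by blast
    \<comment> \<open>Rotating the parameter by \<open>c\<close> changes the sign of \<open>(m z)\<^sup>N\<close>, so \<open>T (c * m)\<close> inverts \<open>1 + a\<close>.\<close>
    obtain c :: complex where c: "cmod c = 1" "c ^ (2^k) = -1"
      using unimodular_root_minus_one by blast
    define T' where "T' m = (1/2) *\<^sub>R (T m + T (c * m))" for m
    have inv': "T' m * (1 - (m *\<^sub>C z) ^ (2^Suc k)) = 1 \<and> (1 - (m *\<^sub>C z) ^ (2^Suc k)) * T' m = 1" for m
    proof -
      define a where "a = (m *\<^sub>C z) ^ (2^k)"
      have "((c * m) *\<^sub>C z) ^ (2^k) = - a"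
        by (simp add: a_def scaleC_power power_mult_distrib c(2) scaleC_minus_left)
      hence P: "T (c * m) * (1 + a) = 1" "(1 + a) * T (c * m) = 1"
        using T(1,2)[of "c * m"] by simp_all
      have Q: "T m * (1 - a) = 1" "(1 - a) * T m = 1" using T(1,2)[of m] by (simp_all add: a_def)
      have a2: "(m *\<^sub>C z) ^ (2^Suc k) = a * a"
        unfolding a_def by (simp flip: power_add add: mult_2)
      have f: "1 - a * a = (1 - a) * (1 + a)" "1 - a * a = (1 + a) * (1 - a)"
        by (simp_all add: algebra_simps)
      have "T m * ((1 - a) * (1 + a)) = 1 + a" "T (c * m) * ((1 + a) * (1 - a)) = 1 - a"
        using P(1) Q(1) by (simp_all flip: mult.assoc)
      moreover have "((1 + a) * (1 - a)) * T m = 1 + a" "((1 - a) * (1 + a)) * T (c * m) = 1 - a"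
        using P(2) Q(2) by (simp_all add: mult.assoc)
      ultimately have "T m * (1 - a * a) = 1 + a" "T (c * m) * (1 - a * a) = 1 - a"
        "(1 - a * a) * T m = 1 + a" "(1 - a * a) * T (c * m) = 1 - a"
        by (simp_all only: f[symmetric])
      moreover have "(1 + a) + (1 - a) = 2 *\<^sub>R 1" by (simp add: scaleR_2)
      hence "(1/2) *\<^sub>R ((1 + a) + (1 - a)) = 1" by (simp only: scaleR_scaleR) simp
      ultimately show ?thesis
        unfolding a2 T'_def by (simp only: mult_scaleR_left mult_scaleR_right distrib_left distrib_right)
    qed
    have "norm (T' m - T' (of_real s * m)) \<le> 1/8" if m: "cmod m = 1" for m
    proof -
      have "T' m - T' (of_real s * m)
        = (1/2) *\<^sub>R ((T m - T (of_real s * m)) + (T (c * m) - T (of_real s * (c * m))))"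
        unfolding T'_def by (simp add: algebra_simps)
      hence "norm (T' m - T' (of_real s * m)) \<le>
          (norm (T m - T (of_real s * m)) + norm (T (c * m) - T (of_real s * (c * m)))) / 2"
        using norm_triangle_ineq by (simp add: divide_simps)
      also have "\<dots> \<le> (1/8 + 1/8) / 2"
        using T(3)[OF m] T(3)[of "c * m"] m c(1) by (simp add: norm_mult)
      finally show ?thesis by simp
    qed
    thus ?case using inv' by blast
  qed
  obtain k where "s ^ k < 1/16" using real_arch_pow_inv[of "1/16" s] s by auto
  moreover have "s ^ (2 ^ k) \<le> s ^ k" using s less_exp[of k] by (intro power_decreasing) auto
  ultimately have k: "s ^ (2 ^ k) < 1/16" by simp
  obtain T where T: "\<And>m. T m * (1 - (m *\<^sub>C z) ^ (2^k)) = 1"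
     "\<And>m. (1 - (m *\<^sub>C z) ^ (2^k)) * T m = 1"
     "\<And>m. cmod m = 1 \<Longrightarrow> norm (T m - T (of_real s * m)) \<le> 1/8" using ex[of k] by blast
  \<comment> \<open>For small \<open>a = (m z)\<^sup>N\<close> this bounds \<open>T m - 1\<close> by \<open>a\<close>; conversely it bounds \<open>a\<close> by \<open>T m - 1\<close>.\<close>
  have TI: "T m - 1 = (m *\<^sub>C z) ^ (2^k) + (T m - 1) * (m *\<^sub>C z) ^ (2^k)" for m
    using T(1)[of m] by (simp add: algebra_simps)
  have nz2: "norm (z ^ (2 ^ k)) = 1" using normal_power_norm[OF normal, of k] nz by simp
  have inside: "norm (T s - 1) \<le> 1/8"
  proof -
    define a where "a = (s *\<^sub>C z) ^ (2^k)"
    have "norm a = s ^ (2 ^ k)" using s nz2 by (simp add: a_def scaleC_power norm_scaleC norm_power)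
    hence a: "norm a < 1/16" using k by simp
    have "norm (T s - 1) \<le> norm a + norm (T s - 1) * norm a"
      using TI[of s] norm_triangle_ineq[of a "(T s - 1) * a"] norm_mult_ineq[of "T s - 1" a]
      by (simp add: a_def)
    also have "norm (T s - 1) * norm a \<le> norm (T s - 1) * (1/16)"
      using a by (intro mult_left_mono) auto
    finally show ?thesis using a by simp
  qed
  have "norm (T 1 - T s) \<le> 1/8" using T(3)[of 1] by simp
  hence "norm (T 1 - 1) \<le> 1/4" using inside norm_triangle_ineq[of "T 1 - T s" "T s - 1"] by simp
  moreover have "z ^ (2^k) = (T 1 - 1) - (T 1 - 1) * z ^ (2^k)"
    using TI[of 1] unfolding eq_diff_eq by simp
  hence "norm (z ^ (2^k)) \<le> norm (T 1 - 1) + norm (T 1 - 1) * norm (z ^ (2^k))"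
    using norm_mult_ineq[of "T 1 - 1" "z ^ (2^k)"] norm_triangle_ineq4[of "T 1 - 1" "(T 1 - 1) * z ^ (2^k)"]
    by simp
  ultimately show False using nz2 by simp
qed

lemma scaled_resolvent_somewhere_singular:
  fixes z :: "'a::unital_cstar_algebra"
  assumes normal: "star z * z = z * star z" and nz: "z \<noteq> 0"
  shows "\<exists>m. \<not> (\<exists>y. y * (1 - m *\<^sub>C z) = 1 \<and> (1 - m *\<^sub>C z) * y = 1)"
proof (rule ccontr)
  assume "\<not> ?thesis"
  hence inv: "\<exists>y. y * (1 - m *\<^sub>C z) = 1 \<and> (1 - m *\<^sub>C z) * y = 1" for m by blast
  define t where "t = complex_of_real (1 / norm z)"
  define z1 where "z1 = t *\<^sub>C z"
  show False
  proof (rule normal_resolvent_not_entire[of z1])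
    show "star z1 * z1 = z1 * star z1"
      using normal by (simp add: z1_def star_scaleC mult_scaleC_left mult_scaleC_right scaleC_scaleC mult.commute)
    show "norm z1 = 1" using nz by (simp add: z1_def t_def norm_scaleC norm_divide)
    show "\<exists>y. y * (1 - m *\<^sub>C z1) = 1 \<and> (1 - m *\<^sub>C z1) * y = 1" for m
      unfolding z1_def scaleC_scaleC by (rule inv)
  qed
qed

text \<open>The closure of \<open>p D\<close> is a nonzero closed ideal because \<open>p\<close> is central, hence it is \<open>D\<close>.  Thus
  \<open>p a\<close> comes within distance \<open>1\<close> of the unit for some \<open>a\<close>, and such a \<open>p a\<close> is invertible.\<close>

lemma simple_cstar_central_invertible:
  assumes D: "simple_cstar D" and p: "p \<in> commutant D D" "p \<noteq> 0"
  shows "\<exists>y. y * p = 1 \<and> p * y = 1"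
proof -
  have sub: "cstar_subalgebra D" using D unfolding simple_cstar_def by auto
  note d = cstar_subalgebraD[OF sub] cstar_subalgebra_zero[OF sub]
  have pD: "p \<in> D" and comm: "\<And>a. a \<in> D \<Longrightarrow> a * p = p * a" using p unfolding commutant_def by auto
  define I where "I = closure ((\<lambda>a. p * a) ` D)"
  \<comment> \<open>Closure properties of \<open>I\<close> need checking only on the dense part \<open>p D\<close>.\<close>
  have mapI: "f x \<in> I"
    if "x \<in> I" "continuous_on UNIV f" "\<And>a. a \<in> D \<Longrightarrow> f (p * a) \<in> I" for f :: "'a \<Rightarrow> 'a" and x
  proof -
    have "f ` closure ((\<lambda>a. p * a) ` D) \<subseteq> I"
    proof (rule image_closure_subset)
      show "continuous_on (closure ((\<lambda>a. p * a) ` D)) f"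
        by (rule continuous_on_subset[OF that(2) subset_UNIV])
      show "closed I" by (simp add: I_def)
      show "f ` (\<lambda>a. p * a) ` D \<subseteq> I" using that(3) by blast
    qed
    thus ?thesis using that(1) unfolding I_def by blast
  qed
  have inI: "p * a \<in> I" if "a \<in> D" for a
    unfolding I_def by (rule closure_subset[THEN subsetD]) (rule imageI[OF that])
  have addI: "x + y \<in> I" if "x \<in> I" "y \<in> I" for x y
  proof (rule mapI[OF that(2)])
    show "x + p * a \<in> I" if "a \<in> D" for a
      using \<open>x \<in> I\<close>
    proof (rule mapI)
      show "p * b + p * a \<in> I" if "b \<in> D" for b
        using inI[of "b + a"] \<open>a \<in> D\<close> that d by (simp add: distrib_left)
    qed (intro continuous_intros)
  qed (intro continuous_intros)
  have "closed_ideal D I"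
    unfolding closed_ideal_def
  proof (intro conjI ballI allI)
    show "I \<subseteq> D" unfolding I_def using d(1) pD d(4) by (intro closure_minimal) auto
    show "closed I" by (simp add: I_def)
    show "0 \<in> I" using inI[of 0] d by simp
    show "x + y \<in> I" if "x \<in> I" "y \<in> I" for x y by (rule addI[OF that])
    show "c *\<^sub>C x \<in> I" if "x \<in> I" for c x
    proof -
      have "x * (c *\<^sub>C 1) \<in> I" using that
      proof (rule mapI)
        show "p * a * (c *\<^sub>C 1) \<in> I" if "a \<in> D" for a
          using inI[of "c *\<^sub>C a"] that d by (simp add: mult_scaleC_right)
      qed (intro continuous_intros)
      thus ?thesis by (simp add: mult_scaleC_right)
    qed
    show "a * x \<in> I" if "a \<in> D" "x \<in> I" for a x
      using that(2)
    proof (rule mapI)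
      show "a * (p * b) \<in> I" if "b \<in> D" for b
        using inI[of "a * b"] that d \<open>a \<in> D\<close> comm[OF \<open>a \<in> D\<close>] by (simp flip: mult.assoc)
    qed (intro continuous_intros)
    show "x * a \<in> I" if "a \<in> D" "x \<in> I" for a x
      using that(2)
    proof (rule mapI)
      show "(p * b) * a \<in> I" if "b \<in> D" for b
        using inI[of "b * a"] that d \<open>a \<in> D\<close> by (simp add: mult.assoc)
    qed (intro continuous_intros)
  qed
  moreover have "I \<noteq> {0}" using inI[of 1] d(2) p(2) by auto
  ultimately have "1 \<in> I" using D d(2) unfolding simple_cstar_def by blast
  then obtain a where a: "a \<in> D" "dist (p * a) 1 < 1"
    unfolding I_def closure_approachable by (metis (no_types, lifting) imageE zero_less_one)
  obtain y where y: "p * a * y = 1" "y * (p * a) = 1"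
    using neumann_inverse[of "1 - p * a"] a(2) by (auto simp: dist_norm norm_minus_commute)
  have "p * (a * y) = 1" "(y * a) * p = 1"
    using y comm[OF a(1)] by (simp_all add: mult.assoc)
  moreover from this have "a * y = y * a" by (metis mult.assoc mult_1 mult_1_right)
  ultimately show ?thesis by metis
qed

text \<open>A central \<open>z\<close> commutes with \<open>star z\<close>, so it is normal and some \<open>1 - m z\<close> is not invertible.  Being
  central, that element must vanish.\<close>

lemma simple_cstar_center:
  assumes D: "simple_cstar D" and z: "z \<in> commutant D D"
  shows "\<exists>c. z = c *\<^sub>C 1"
proof (cases "z = 0")
  case True
  thus ?thesis by (intro exI[of _ 0]) simp
next
  case False
  have sub: "cstar_subalgebra D" using D unfolding simple_cstar_def by auto
  have sub': "cstar_subalgebra (commutant D D)"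
    using cstar_subalgebra_commutant[OF sub] cstar_subalgebraD(6)[OF sub] by blast
  have "star z * z = z * star z"
    using z cstar_subalgebraD(6)[OF sub, of z] unfolding commutant_def by auto
  from scaled_resolvent_somewhere_singular[OF this False] obtain m
    where m: "\<not> (\<exists>y. y * (1 - m *\<^sub>C z) = 1 \<and> (1 - m *\<^sub>C z) * y = 1)" by blast
  have "1 - m *\<^sub>C z \<in> commutant D D"
    by (intro cstar_subalgebra_diff[OF sub'] cstar_subalgebraD(2,5)[OF sub'] z)
  with m simple_cstar_central_invertible[OF D] have e: "m *\<^sub>C z = 1" by fastforce
  hence "m \<noteq> 0" by auto
  have "z = inverse m *\<^sub>C m *\<^sub>C z" using \<open>m \<noteq> 0\<close> by (simp add: scaleC_scaleC)
  thus ?thesis using e by metis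
qed

section \<open>Conditional expectations and quasi-bases\<close>

lemma conditional_expectationD:
  assumes "conditional_expectation B A E"
  shows "\<And>x. x \<in> A \<Longrightarrow> E x \<in> B"
    and "\<And>x y. x \<in> A \<Longrightarrow> y \<in> A \<Longrightarrow> E (x + y) = E x + E y"
    and "\<And>c x. x \<in> A \<Longrightarrow> E (c *\<^sub>C x) = c *\<^sub>C E x"
    and "\<And>b. b \<in> B \<Longrightarrow> E b = b"
    and "\<And>b x. b \<in> B \<Longrightarrow> x \<in> A \<Longrightarrow> E (b * x) = b * E x"
    and "\<And>b x. b \<in> B \<Longrightarrow> x \<in> A \<Longrightarrow> E (x * b) = E x * b"
    and "\<And>x. x \<in> A \<Longrightarrow> \<exists>b\<in>B. E (star x * x) = star b * b"
  using assms unfolding conditional_expectation_def by blast+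

lemma conditional_expectation_sum:
  assumes "conditional_expectation B A E" "cstar_subalgebra A" "cstar_subalgebra B"
    and "\<And>i. i \<in> I \<Longrightarrow> f i \<in> A"
  shows "E (\<Sum>i\<in>I. f i) = (\<Sum>i\<in>I. E (f i))"
  using assms(4)
proof (induction I rule: infinite_finite_induct)
  case (insert i I)
  thus ?case
    using conditional_expectationD(2)[OF assms(1), of "f i" "sum f I"]
      cstar_subalgebra_sum[OF assms(2), of I f] by simp
qed (use conditional_expectationD(4)[OF assms(1)] cstar_subalgebra_zero[OF assms(3)] in auto)

lemma conditional_expectation_diff:
  assumes "conditional_expectation B A E" "cstar_subalgebra A" "x \<in> A" "y \<in> A"
  shows "E (x - y) = E x - E y"
proof -
  have "E (x + (-1) *\<^sub>C y) = E x + (-1) *\<^sub>C E y"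
    using assms conditional_expectationD(2,3)[OF assms(1)] cstar_subalgebraD(5)[OF assms(2)] by metis
  thus ?thesis by (simp add: scaleC_minus_one)
qed

text \<open>Positivity makes \<open>E(y* y)\<close> self-adjoint for each \<open>y\<close>.  Polarisation with \<open>y = x + c 1\<close> shows that
  \<open>cnj c E(x) + c E(x*)\<close> is self-adjoint, and the cases \<open>c = 1\<close> and \<open>c = \<i>\<close> together determine
  \<open>E(x*)\<close>.\<close>

lemma conditional_expectation_star:
  assumes E: "conditional_expectation B A E" and A: "cstar_subalgebra A"
    and B: "cstar_subalgebra B" and x: "x \<in> A"
  shows "E (star x) = star (E x)"
proof -
  note e = conditional_expectationD[OF E] and a = cstar_subalgebraD[OF A]
  have sa: "star (E (star y * y)) = E (star y * y)" if "y \<in> A" for y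
    using e(7)[OF that] by (auto simp: star_mult star_star)
  have E1: "E 1 = 1" using e(4) cstar_subalgebraD(2)[OF B] by simp
  have c: "star (cnj c *\<^sub>C E x + c *\<^sub>C E (star x)) = cnj c *\<^sub>C E x + c *\<^sub>C E (star x)" for c
  proof -
    define y where "y = x + c *\<^sub>C 1"
    have y: "y \<in> A" using x a by (simp add: y_def)
    have "star y * y = (star x * x + (cnj c *\<^sub>C x + c *\<^sub>C star x)) + (cnj c * c) *\<^sub>C 1"
      by (simp add: y_def star_add star_scaleC distrib_left distrib_right mult_scaleC_left
          mult_scaleC_right scaleC_scaleC scaleC_add_right mult.commute)
    hence "E (star y * y)
        = (E (star x * x) + (cnj c *\<^sub>C E x + c *\<^sub>C E (star x))) + (cnj c * c) *\<^sub>C 1"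
      using x a e(2,3) E1 by simp
    moreover have "star ((cnj c * c) *\<^sub>C (1::'a)) = (cnj c * c) *\<^sub>C 1"
      by (simp add: star_scaleC mult.commute)
    ultimately show ?thesis
      using sa[OF y] sa[OF x] by (simp only: star_add) simp
  qed
  have "star (E x) + star (E (star x)) = E x + E (star x)"
    using c[of 1] by (simp add: star_add)
  moreover have "star (E x) - star (E (star x)) = E (star x) - E x"
  proof (rule scaleC_left_cancel[of \<i>])
    show "\<i> *\<^sub>C (star (E x) - star (E (star x))) = \<i> *\<^sub>C (E (star x) - E x)"
      using c[of \<i>] by (simp add: star_add star_scaleC star_diff scaleC_minus_left scaleC_diff_right)
  qed simp
  ultimately have "(star (E x) + star (E (star x))) + (star (E x) - star (E (star x)))
      = (E x + E (star x)) + (E (star x) - E x)" by (simp only:)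
  hence "2 *\<^sub>R star (E x) = 2 *\<^sub>R E (star x)" unfolding scaleR_2 by simp
  thus ?thesis by simp
qed

lemma conditional_expectation_commutant:
  assumes E: "conditional_expectation B A E" and B: "simple_cstar B" and s: "s \<in> commutant B A"
  shows "\<exists>c. E s = c *\<^sub>C 1"
proof (rule simple_cstar_center[OF B])
  have "s \<in> A" using s unfolding commutant_def by auto
  have "b * E s = E s * b" if "b \<in> B" for b
  proof -
    have "b * s = s * b" using s that unfolding commutant_def by auto
    thus ?thesis using conditional_expectationD(5,6)[OF E that \<open>s \<in> A\<close>] by simp
  qed
  thus "E s \<in> commutant B B"
    using conditional_expectationD(1)[OF E \<open>s \<in> A\<close>] unfolding commutant_def by auto
qed

text \<open>The map \<open>\<theta>\<close> on \<open>B' \<inter> A\<close>.  Its value at \<open>1\<close> is the Watatani index, and on the relative commutant it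
  depends only on the expectation.\<close>

definition index_map :: "nat \<Rightarrow> (nat \<Rightarrow> 'a) \<Rightarrow> (nat \<Rightarrow> 'a) \<Rightarrow> 'a \<Rightarrow> 'a::unital_cstar_algebra" where
  "index_map n u v s = (\<Sum>i<n. u i * s * v i)"

lemma quasi_basisD:
  assumes "quasi_basis A E n u v"
  shows "\<And>i. i < n \<Longrightarrow> u i \<in> A" "\<And>i. i < n \<Longrightarrow> v i \<in> A"
    "\<And>x. x \<in> A \<Longrightarrow> (\<Sum>i<n. u i * E (v i * x)) = x" "\<And>x. x \<in> A \<Longrightarrow> (\<Sum>i<n. E (x * u i) * v i) = x"
  using assms unfolding quasi_basis_def by metis+

text \<open>Expand \<open>a u'\<^sub>j\<close> in the first quasi-basis; its coefficients lie in \<open>B\<close>, so they pass through \<open>s\<close>, and the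
  sum over \<open>j\<close> then reassembles \<open>v\<^sub>i a\<close> in the second.  With \<open>a = 1\<close> this says that
  \<open>\<theta>\<close> does not depend on the quasi-basis, and with a single quasi-basis that \<open>\<theta>(s)\<close> is central.\<close>

lemma index_map_transfer:
  assumes E: "conditional_expectation B A E" and A: "cstar_subalgebra A"
    and uv: "quasi_basis A E n u v" and uv': "quasi_basis A E m u' v'"
    and s: "s \<in> commutant B A" and a: "a \<in> A"
  shows "a * index_map m u' v' s = index_map n u v s * a"
proof -
  note q = quasi_basisD[OF uv] and q' = quasi_basisD[OF uv'] and mem = cstar_subalgebraD(4)[OF A]
  have sc: "E x * s = s * E x" if "x \<in> A" for x
    using s conditional_expectationD(1)[OF E that] unfolding commutant_def by auto
  have "a * index_map m u' v' s = (\<Sum>j<m. (a * u' j) * s * v' j)"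
    by (simp add: index_map_def sum_distrib_left mult.assoc)
  also have "\<dots> = (\<Sum>j<m. (\<Sum>i<n. u i * E (v i * (a * u' j))) * s * v' j)"
    using q(3) q'(1) mem[OF a] by (intro sum.cong) auto
  also have "\<dots> = (\<Sum>j<m. \<Sum>i<n. u i * s * (E (v i * a * u' j) * v' j))"
  proof (intro sum.cong refl)
    fix j assume j: "j \<in> {..<m}"
    have "u i * E (v i * (a * u' j)) * s * v' j = u i * s * (E (v i * a * u' j) * v' j)"
      if "i < n" for i
      using sc[of "v i * a * u' j"] q(2)[OF that] q'(1) j a mem by (simp add: mult.assoc)
    thus "(\<Sum>i<n. u i * E (v i * (a * u' j))) * s * v' j
        = (\<Sum>i<n. u i * s * (E (v i * a * u' j) * v' j))"
      unfolding sum_distrib_right by (intro sum.cong) auto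
  qed
  also have "\<dots> = (\<Sum>i<n. u i * s * (\<Sum>j<m. E (v i * a * u' j) * v' j))"
    by (subst sum.swap) (simp add: sum_distrib_left)
  also have "\<dots> = (\<Sum>i<n. u i * s * (v i * a))"
    using q'(4) q(2) mem a by (intro sum.cong) auto
  finally show ?thesis by (simp add: index_map_def sum_distrib_right mult.assoc)
qed

lemma index_map_unique:
  assumes "conditional_expectation B A E" "cstar_subalgebra A"
    "quasi_basis A E n u v" "quasi_basis A E m u' v'" "s \<in> commutant B A"
  shows "index_map m u' v' s = index_map n u v s"
  using index_map_transfer[OF assms, of 1] cstar_subalgebraD(2)[OF assms(2)] by simp

lemma index_map_scalar:
  assumes E: "conditional_expectation B A E" and A: "simple_cstar A"
    and uv: "quasi_basis A E n u v" and s: "s \<in> commutant B A"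
  shows "index_map n u v s = scalar_of (index_map n u v s) *\<^sub>C 1"
proof -
  have sub: "cstar_subalgebra A" using A unfolding simple_cstar_def by auto
  have "index_map n u v s \<in> A"
    using quasi_basisD(1,2)[OF uv] s cstar_subalgebraD(4)[OF sub]
    unfolding index_map_def commutant_def by (intro cstar_subalgebra_sum[OF sub]) auto
  hence "index_map n u v s \<in> commutant A A"
    using index_map_transfer[OF E sub uv uv s] unfolding commutant_def by auto
  from simple_cstar_center[OF A this] show ?thesis by auto
qed

lemma quasi_basis_star:
  assumes E: "conditional_expectation B A E" and A: "cstar_subalgebra A" and B: "cstar_subalgebra B"
    and uv: "quasi_basis A E n u v"
  shows "quasi_basis A E n (\<lambda>i. star (v i)) (\<lambda>i. star (u i))"
proof -
  note q = quasi_basisD[OF uv] and a = cstar_subalgebraD[OF A]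
  have st: "E (star y) = star (E y)" if "y \<in> A" for y
    by (rule conditional_expectation_star[OF E A B that])
  have "(\<Sum>i<n. star (v i) * E (star (u i) * x)) = x" "(\<Sum>i<n. E (x * star (v i)) * star (u i)) = x"
    if x: "x \<in> A" for x
  proof -
    have "(\<Sum>i<n. star (v i) * E (star (u i) * x)) = star (\<Sum>i<n. E (star x * u i) * v i)"
      unfolding star_sum
    proof (intro sum.cong refl)
      fix i assume "i \<in> {..<n}"
      thus "star (v i) * E (star (u i) * x) = star (E (star x * u i) * v i)"
        using st[of "star x * u i"] q a x by (simp add: star_mult star_star)
    qed
    thus "(\<Sum>i<n. star (v i) * E (star (u i) * x)) = x" using q(4) a x by (simp add: star_star)
    have "(\<Sum>i<n. E (x * star (v i)) * star (u i)) = star (\<Sum>i<n. u i * E (v i * star x))"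
      unfolding star_sum
    proof (intro sum.cong refl)
      fix i assume "i \<in> {..<n}"
      thus "E (x * star (v i)) * star (u i) = star (u i * E (v i * star x))"
        using st[of "v i * star x"] q a x by (simp add: star_mult star_star)
    qed
    thus "(\<Sum>i<n. E (x * star (v i)) * star (u i)) = x" using q(3) a x by (simp add: star_star)
  qed
  thus ?thesis unfolding quasi_basis_def using q(1,2) a(6) by simp
qed

lemma index_map_star:
  assumes E: "conditional_expectation B A E" and A: "cstar_subalgebra A" and B: "cstar_subalgebra B"
    and uv: "quasi_basis A E n u v" and s: "s \<in> commutant B A"
  shows "index_map n u v (star s) = star (index_map n u v s)"
proof -
  have sub: "cstar_subalgebra (commutant B A)"
    using cstar_subalgebra_commutant[OF A] cstar_subalgebraD(6)[OF B] by blast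
  have "star (index_map n u v s) = index_map n (\<lambda>i. star (v i)) (\<lambda>i. star (u i)) (star s)"
    by (simp add: index_map_def star_sum star_mult mult.assoc)
  also have "\<dots> = index_map n u v (star s)"
    by (rule index_map_unique[OF E A uv quasi_basis_star[OF E A B uv]])
      (rule cstar_subalgebraD(6)[OF sub s])
  finally show ?thesis by simp
qed

lemma watatani_index_eq:
  assumes E: "conditional_expectation B A E" and A: "cstar_subalgebra A" and uv: "quasi_basis A E n u v"
  shows "watatani_index A E = index_map n u v 1"
  unfolding watatani_index_def
proof (rule the_equality)
  show "\<exists>n' u' v'. quasi_basis A E n' u' v' \<and> index_map n u v 1 = (\<Sum>i<n'. u' i * v' i)"
    using uv by (auto simp: index_map_def)
  fix z assume "\<exists>n' u' v'. quasi_basis A E n' u' v' \<and> z = (\<Sum>i<n'. u' i * v' i)"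
  then obtain m u' v' where z: "quasi_basis A E m u' v'" "z = index_map m u' v' 1"
    by (auto simp: index_map_def)
  have "1 \<in> commutant B A" using cstar_subalgebraD(2)[OF A] by (simp add: commutant_def)
  thus "z = index_map n u v 1" using index_map_unique[OF E A uv z(1)] z(2) by simp
qed

text \<open>The index is scalar because \<open>A\<close> is simple, and the scalar is real because \<open>\<theta>\<close> preserves adjoints.  So
  the definite description in the scalar index does denote.\<close>

lemma index_map_one_eq_scalar_index:
  assumes E: "conditional_expectation B A E" and A: "simple_cstar A" and B: "cstar_subalgebra B"
    and uv: "quasi_basis A E n u v"
  shows "index_map n u v 1 = complex_of_real (scalar_index A E) *\<^sub>C 1"
proof -
  have sub: "cstar_subalgebra A" using A unfolding simple_cstar_def by auto
  have one: "1 \<in> commutant B A" using cstar_subalgebraD(2)[OF sub] by (simp add: commutant_def)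
  define c where "c = scalar_of (index_map n u v 1)"
  have c: "index_map n u v 1 = c *\<^sub>C 1" unfolding c_def by (rule index_map_scalar[OF E A uv one])
  have "star (c *\<^sub>C (1::'a)) = c *\<^sub>C 1" using index_map_star[OF E sub B uv one] c by simp
  hence "cnj c = c" by (simp add: star_scaleC scaleC_one_inject)
  hence r: "complex_of_real (Re c) = c" by (simp add: complex_eq_iff)
  have or: "(of_real r :: 'a) = complex_of_real r *\<^sub>C 1" for r
    unfolding scaleC_of_real by (rule of_real_def)
  have "scalar_index A E = Re c"
    unfolding scalar_index_def watatani_index_eq[OF E sub uv] c or scaleC_one_inject
    by (rule the_equality) (use r in auto)
  thus ?thesis using c r by simp
qed

section \<open>Minimality\<close>

text \<open>The linear term dominates for small \<open>\<epsilon>\<close> and changes sign with \<open>\<epsilon>\<close>, so it must vanish.\<close>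

lemma linear_coefficient_zero:
  fixes \<rho> Q \<delta> :: real
  assumes "\<delta> > 0" and le: "\<And>\<epsilon>. \<bar>\<epsilon>\<bar> \<le> \<delta> \<Longrightarrow> 0 \<le> \<epsilon> * \<rho> + \<epsilon>\<^sup>2 * Q"
  shows "\<rho> = 0"
proof (rule ccontr)
  assume r: "\<rho> \<noteq> 0"
  define t where "t = min (\<delta> / \<bar>\<rho>\<bar>) (1 / (2 * (\<bar>Q\<bar> + 1)))"
  have t0: "t > 0" using r assms(1) by (simp add: t_def)
  have "t * \<bar>\<rho>\<bar> \<le> (\<delta> / \<bar>\<rho>\<bar>) * \<bar>\<rho>\<bar>" by (rule mult_right_mono) (auto simp: t_def)
  hence "\<bar>- (t * \<rho>)\<bar> \<le> \<delta>" using r t0 by (simp add: abs_mult)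
  from le[OF this] have "0 \<le> (t * \<rho>\<^sup>2) * (t * Q - 1)"
    by (simp add: power2_eq_square algebra_simps)
  moreover have "t * \<rho>\<^sup>2 > 0" using t0 r by simp
  ultimately have "t * Q - 1 \<ge> 0" by (simp add: zero_le_mult_iff)
  moreover have "t * Q \<le> t * (\<bar>Q\<bar> + 1)" using t0 by (intro mult_left_mono) auto
  moreover have "t * (\<bar>Q\<bar> + 1) \<le> 1 / (2 * (\<bar>Q\<bar> + 1)) * (\<bar>Q\<bar> + 1)"
    by (intro mult_right_mono) (auto simp: t_def)
  moreover have "1 / (2 * (\<bar>Q\<bar> + 1)) * (\<bar>Q\<bar> + 1) = 1/2" by (simp add: field_simps)
  ultimately show False by linarith
qed

text \<open>The variation of \<open>E\<close> along which minimality is exploited.  Since \<open>g\<close> and its inverse \<open>y\<close> commute with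
  \<open>B\<close>, twisting by \<open>g\<close> preserves the bimodule property, and a quasi-basis is twisted by
  \<open>y\<close> on the inner sides.\<close>

lemma perturbed_expectation:
  assumes E: "conditional_expectation B A E" and A: "cstar_subalgebra A" and B: "cstar_subalgebra B"
    and uv: "quasi_basis A E n u v"
    and g: "g \<in> commutant B A" and y: "y \<in> commutant B A" and gy: "g * y = 1" "y * g = 1"
    and c: "E (star g * g) = c *\<^sub>R 1" "c > 0"
  defines "F \<equiv> \<lambda>x. (1 / c) *\<^sub>R E (star g * x * g)"
  shows "conditional_expectation B A F"
    and "quasi_basis A F n (\<lambda>i. c *\<^sub>R (u i * y)) (\<lambda>i. star y * v i)"
proof -
  note e = conditional_expectationD[OF E] and a = cstar_subalgebraD[OF A]
    and b = cstar_subalgebraD[OF B] and q = quasi_basisD[OF uv]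
  have sub: "cstar_subalgebra (commutant B A)"
    using cstar_subalgebra_commutant[OF A] b(6) by blast
  have AR: "r *\<^sub>R x \<in> A" if "x \<in> A" for r x
    using a(5)[OF that, of "complex_of_real r"] by (simp add: scaleC_of_real)
  have BR: "r *\<^sub>R x \<in> B" if "x \<in> B" for r x
    using b(5)[OF that, of "complex_of_real r"] by (simp add: scaleC_of_real)
  have ER: "E (r *\<^sub>R x) = r *\<^sub>R E x" if "x \<in> A" for r x
    using e(3)[OF that, of "complex_of_real r"] by (simp add: scaleC_of_real)
  have sg: "star g \<in> commutant B A" and sy: "star y \<in> commutant B A"
    using cstar_subalgebraD(6)[OF sub] g y by auto
  have mem: "g \<in> A" "y \<in> A" "star g \<in> A" "star y \<in> A" using g y sg sy unfolding commutant_def by auto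
  have cg: "t * g = g * t" and cy: "t * y = y * t" and csg: "t * star g = star g * t"
    and csy: "t * star y = star y * t" if "t \<in> B" for t
    using g y sg sy that unfolding commutant_def by auto
  have sgy: "star g * star y = 1" "star y * star g = 1" using gy by (simp_all flip: star_mult)
  have mm: "star g * x * g \<in> A" if "x \<in> A" for x using that mem a by simp
  show "conditional_expectation B A F"
    unfolding conditional_expectation_def
  proof (intro conjI ballI allI)
    show "F x \<in> B" if "x \<in> A" for x using BR e(1) mm that by (simp add: F_def)
    show "F (x + z) = F x + F z" if "x \<in> A" "z \<in> A" for x z
      using e(2)[OF mm[OF that(1)] mm[OF that(2)]]
      by (simp add: F_def distrib_left distrib_right scaleR_add_right)
    show "F (k *\<^sub>C x) = k *\<^sub>C F x" if "x \<in> A" for k x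
      using e(3)[OF mm[OF that]]
      by (simp add: F_def mult_scaleC_left mult_scaleC_right scaleC_scaleC mult.commute
          flip: scaleC_of_real)
    show "F t = t" if "t \<in> B" for t
    proof -
      have "star g * t * g = t * (star g * g)" using csg[OF that] by (simp flip: mult.assoc)
      thus ?thesis using e(5)[OF that, of "star g * g"] mem a c by (simp add: F_def)
    qed
    show "F (t * x) = t * F x" if "t \<in> B" "x \<in> A" for t x
    proof -
      have "star g * (t * x) * g = t * (star g * x * g)"
        using csg[OF that(1)] by (simp flip: mult.assoc)
      thus ?thesis using e(5)[OF that(1) mm[OF that(2)]] by (simp add: F_def)
    qed
    show "F (x * t) = F x * t" if "t \<in> B" "x \<in> A" for t x
    proof -
      have "star g * (x * t) * g = (star g * x * g) * t"
        using cg[OF that(1)] by (simp add: mult.assoc)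
      thus ?thesis using e(6)[OF that(1) mm[OF that(2)]] by (simp add: F_def)
    qed
    show "\<exists>t\<in>B. F (star x * x) = star t * t" if "x \<in> A" for x
    proof -
      have "star g * (star x * x) * g = star (x * g) * (x * g)" by (simp add: star_mult mult.assoc)
      moreover obtain t where t: "t \<in> B" "E (star (x * g) * (x * g)) = star t * t"
        using e(7)[OF a(4)[OF \<open>x \<in> A\<close> mem(1)]] by blast
      moreover define r where "r = 1 / sqrt c"
      moreover have "star (r *\<^sub>R t) * (r *\<^sub>R t) = (r * r) *\<^sub>R (star t * t)"
        by (simp add: star_scaleC flip: scaleC_of_real)
          (simp add: mult_scaleC_left mult_scaleC_right scaleC_scaleC)
      moreover have "r * r = 1 / c" using c(2) by (simp add: r_def real_div_sqrt)
      ultimately have "F (star x * x) = star (r *\<^sub>R t) * (r *\<^sub>R t)" by (simp add: F_def)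
      thus ?thesis using BR[OF t(1)] by blast
    qed
  qed
  show "quasi_basis A F n (\<lambda>i. c *\<^sub>R (u i * y)) (\<lambda>i. star y * v i)"
    unfolding quasi_basis_def
  proof (intro conjI allI impI ballI)
    show "c *\<^sub>R (u i * y) \<in> A" if "i < n" for i using AR a q(1)[OF that] mem by simp
    show "star y * v i \<in> A" if "i < n" for i using a q(2)[OF that] mem by simp
    fix x assume x: "x \<in> A"
    have 1: "c *\<^sub>R (u i * y) * F (star y * v i * x) = u i * E (v i * (x * g)) * y" if "i < n" for i
    proof -
      have "star g * (star y * v i * x) * g = v i * (x * g)"
        using sgy by (simp flip: mult.assoc)
      hence "c *\<^sub>R (u i * y) * F (star y * v i * x) = u i * (y * E (v i * (x * g)))"
        using c by (simp add: F_def mult.assoc)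
      also have "y * E (v i * (x * g)) = E (v i * (x * g)) * y"
        using cy[OF e(1)[of "v i * (x * g)"]] q(2)[OF that] x mem a by simp
      finally show ?thesis by (simp add: mult.assoc)
    qed
    have "(\<Sum>i<n. c *\<^sub>R (u i * y) * F (star y * v i * x)) = (\<Sum>i<n. u i * E (v i * (x * g))) * y"
      unfolding sum_distrib_right using 1 by (intro sum.cong) auto
    also have "\<dots> = x" using q(3)[of "x * g"] x mem a gy by (simp add: mult.assoc)
    finally show "x = (\<Sum>i<n. c *\<^sub>R (u i * y) * F (star y * v i * x))" by simp
    have 2: "F (x * c *\<^sub>R (u i * y)) * (star y * v i) = star y * (E (star g * x * u i) * v i)"
      if "i < n" for i
    proof -
      have m: "star g * x * u i \<in> A" using q(1)[OF that] x mem a by simp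
      have "star g * (x * c *\<^sub>R (u i * y)) * g = c *\<^sub>R (star g * x * u i)"
        using gy by (simp add: mult.assoc)
      hence "F (x * c *\<^sub>R (u i * y)) = E (star g * x * u i)"
        using c ER[OF m] by (simp add: F_def)
      thus ?thesis using csy[OF e(1)[OF m]] by (simp flip: mult.assoc)
    qed
    have "(\<Sum>i<n. F (x * c *\<^sub>R (u i * y)) * (star y * v i))
      = star y * (\<Sum>i<n. E (star g * x * u i) * v i)"
      unfolding sum_distrib_left using 2 by (intro sum.cong) auto
    also have "\<dots> = x" using q(4)[of "star g * x"] x mem a sgy by (simp flip: mult.assoc)
    finally show "x = (\<Sum>i<n. F (x * c *\<^sub>R (u i * y)) * (star y * v i))" by simp
  qed
qed

lemma index_map_add: "index_map n u v (s + t) = index_map n u v s + index_map n u v t"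
  by (simp add: index_map_def distrib_left distrib_right sum.distrib)

lemma index_map_scaleC: "index_map n u v (c *\<^sub>C s) = c *\<^sub>C index_map n u v s"
  by (simp add: index_map_def mult_scaleC_left mult_scaleC_right scaleC_sum_right)

lemma index_map_bound: "norm (index_map n u v s) \<le> (\<Sum>i<n. norm (u i) * norm (v i)) * norm s"
proof -
  have "norm (u i * s * v i) \<le> norm (u i) * norm (v i) * norm s" for i
  proof -
    have "norm (u i * s * v i) \<le> norm (u i) * norm s * norm (v i)"
      by (meson mult_right_mono norm_ge_zero norm_mult_ineq order_trans)
    thus ?thesis by (simp add: ac_simps)
  qed
  hence "(\<Sum>i<n. norm (u i * s * v i)) \<le> (\<Sum>i<n. norm (u i) * norm (v i) * norm s)"
    by (intro sum_mono)
  thus ?thesis using norm_sum[of "\<lambda>i. u i * s * v i" "{..<n}"]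
    by (simp add: index_map_def sum_distrib_right)
qed

text \<open>For \<open>y = (1 - \<epsilon> k)\<^sup>-\<^sup>1 = 1 + \<epsilon> k + \<epsilon>\<^sup>2 r\<close> with \<open>r = k\<^sup>2 y\<close>, multiply out \<open>y y*\<close>.  As \<open>\<parallel>y\<parallel> \<le> 2\<close> and hence
  \<open>\<parallel>r\<parallel> \<le> 2 K\<^sup>2\<close>, the four summands of the bound correspond to \<open>r + r*\<close>, \<open>k k*\<close>, the mixed
  terms, and \<open>r r*\<close>.  What matters is that it does not depend on \<open>\<epsilon>\<close>.\<close>

lemma inverse_expansion:
  fixes k y :: "'a::unital_cstar_algebra"
  assumes y: "(1 - \<epsilon> *\<^sub>R k) * y = 1" and \<epsilon>: "\<bar>\<epsilon>\<bar> \<le> 1" "\<bar>\<epsilon>\<bar> * norm k \<le> 1/2"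
  defines "K \<equiv> norm k"
  obtains R where "y * star y = 1 + \<epsilon> *\<^sub>R (k + star k) + \<epsilon>\<^sup>2 *\<^sub>R R"
    "norm R \<le> 4 * K\<^sup>2 + K\<^sup>2 + 4 * K ^ 3 + 4 * K ^ 4"
proof -
  have y1: "y = 1 + \<epsilon> *\<^sub>R (k * y)" using y by (simp add: left_diff_distrib algebra_simps)
  have "norm y \<le> 1 + \<bar>\<epsilon>\<bar> * (K * norm y)"
  proof -
    have "norm y \<le> norm (1::'a) + norm (\<epsilon> *\<^sub>R (k * y))"
      by (subst (1) y1) (rule norm_triangle_ineq)
    also have "norm (\<epsilon> *\<^sub>R (k * y)) \<le> \<bar>\<epsilon>\<bar> * (K * norm y)"
      by (simp add: K_def mult_left_mono norm_mult_ineq)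
    finally show ?thesis by simp
  qed
  also have "\<bar>\<epsilon>\<bar> * (K * norm y) \<le> 1/2 * norm y"
    using mult_right_mono[OF \<epsilon>(2), of "norm y"] by (simp add: K_def mult.assoc)
  finally have ny: "norm y \<le> 2" by simp
  define r where "r = k * (k * y)"
  have y2: "y = 1 + \<epsilon> *\<^sub>R k + \<epsilon>\<^sup>2 *\<^sub>R r"
  proof -
    have "y = 1 + \<epsilon> *\<^sub>R (k * (1 + \<epsilon> *\<^sub>R (k * y)))" using y1 by simp
    thus ?thesis by (simp add: r_def distrib_left scaleR_add_right power2_eq_square add.assoc)
  qed
  have starR: "star (a *\<^sub>R x) = a *\<^sub>R star x" for a and x :: 'a
    using star_scaleC[of "complex_of_real a" x] by (simp add: scaleC_of_real)
  have sy2: "star y = 1 + \<epsilon> *\<^sub>R star k + \<epsilon>\<^sup>2 *\<^sub>R star r"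
    by (subst y2) (simp add: star_add starR)
  define R where "R = (r + star r) + k * star k + \<epsilon> *\<^sub>R (k * star r + r * star k) + \<epsilon>\<^sup>2 *\<^sub>R (r * star r)"
  have eq: "y * star y = 1 + \<epsilon> *\<^sub>R (k + star k) + \<epsilon>\<^sup>2 *\<^sub>R R"
    unfolding sy2 by (subst y2) (simp add: R_def algebra_simps power2_eq_square)
  have nr: "norm r \<le> 2 * K\<^sup>2"
  proof -
    have "norm r \<le> K * (K * norm y)"
      unfolding r_def K_def
      by (meson mult_left_mono norm_ge_zero norm_mult_ineq order_trans)
    also have "\<dots> \<le> K * (K * 2)" using ny by (intro mult_left_mono) (auto simp: K_def)
    finally show ?thesis by (simp add: power2_eq_square)
  qed
  have p1: "norm (r + star r) \<le> 4 * K\<^sup>2" using norm_triangle_ineq[of r "star r"] nr by simp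
  have p2: "norm (k * star k) \<le> K\<^sup>2"
    using norm_mult_ineq[of k "star k"] by (simp add: K_def power2_eq_square)
  have p3: "norm (\<epsilon> *\<^sub>R (k * star r + r * star k)) \<le> 4 * K ^ 3"
  proof -
    have "norm (k * star r + r * star k) \<le> K * norm r + norm r * K"
      using norm_triangle_ineq[of "k * star r" "r * star k"]
        norm_mult_ineq[of k "star r"] norm_mult_ineq[of r "star k"]
      unfolding K_def norm_star by linarith
    also have "\<dots> = 2 * K * norm r" by simp
    also have "\<dots> \<le> 2 * K * (2 * K\<^sup>2)" using nr by (intro mult_left_mono) (auto simp: K_def)
    finally have "norm (k * star r + r * star k) \<le> 4 * K ^ 3"
      by (simp add: power2_eq_square power3_eq_cube)
    thus ?thesis using \<epsilon>(1) mult_mono[of "\<bar>\<epsilon>\<bar>" 1 "norm (k * star r + r * star k)"] by simp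
  qed
  have p4: "norm (\<epsilon>\<^sup>2 *\<^sub>R (r * star r)) \<le> 4 * K ^ 4"
  proof -
    have "norm (r * star r) \<le> norm r * norm r" using norm_mult_ineq[of r "star r"] by simp
    also have "\<dots> \<le> (2 * K\<^sup>2) * (2 * K\<^sup>2)" using nr by (intro mult_mono) auto
    finally have "norm (r * star r) \<le> 4 * K ^ 4" by (simp add: power2_eq_square power4_eq_xxxx)
    moreover have "\<epsilon>\<^sup>2 \<le> 1" using \<epsilon>(1) by (simp add: abs_square_le_1)
    ultimately show ?thesis using mult_mono[of "\<epsilon>\<^sup>2" 1 "norm (r * star r)"] by simp
  qed
  have "norm R \<le> 4 * K\<^sup>2 + K\<^sup>2 + 4 * K ^ 3 + 4 * K ^ 4"
    unfolding R_def by (intro norm_triangle_mono p1 p2 p3 p4)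
  with eq that show ?thesis by blast
qed

text \<open>Compare the index of \<open>E\<close> with that of its perturbation by \<open>g = 1 - \<epsilon> k\<close>.  The
  normalising factor \<open>E(g* g) = 1 + \<epsilon>\<^sup>2 M\<close> has no linear term because \<open>E(k) = 0\<close>, so the linear
  term of the index is \<open>\<theta>(k + k*) = 2 Re \<theta>(k)\<close>.\<close>

lemma index_map_kernel_real_part:
  assumes Bs: "simple_cstar B" and As: "simple_cstar A"
    and min: "minimal_conditional_expectation B A E" and uv: "quasi_basis A E n u v"
    and k: "k \<in> commutant B A" and Ek: "E k = 0"
  shows "Re (scalar_of (index_map n u v k)) = 0"
proof -
  have A: "cstar_subalgebra A" and B: "cstar_subalgebra B" using As Bs by (auto simp: simple_cstar_def)
  have E: "conditional_expectation B A E"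
    using min by (auto simp: minimal_conditional_expectation_def index_finite_type_def)
  have N: "cstar_subalgebra (commutant B A)"
    using cstar_subalgebra_commutant[OF A] cstar_subalgebraD(6)[OF B] by blast
  have NR: "r *\<^sub>R x \<in> commutant B A" if "x \<in> commutant B A" for r x
    using cstar_subalgebraD(5)[OF N that, of "complex_of_real r"] by (simp add: scaleC_of_real)
  note n = cstar_subalgebraD[OF N]
  have NA: "x \<in> A" if "x \<in> commutant B A" for x using that by (simp add: commutant_def)
  define L where "L s = scalar_of (index_map n u v s)" for s
  have L: "index_map n u v s = L s *\<^sub>C 1" if "s \<in> commutant B A" for s
    unfolding L_def by (rule index_map_scalar[OF E As uv that])
  have Lplus: "L (s + t) = L s + L t" if "s \<in> commutant B A" "t \<in> commutant B A" for s t
    using L[OF that(1)] L[OF that(2)] unfolding L_def[of "s + t"] index_map_add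
    by (simp flip: scaleC_add_left)
  have LR: "L (r *\<^sub>R s) = of_real r * L s" if "s \<in> commutant B A" for r s
    using L[OF that] index_map_scaleC[of n u v "complex_of_real r" s] unfolding L_def[of "r *\<^sub>R s"]
    by (simp add: scaleC_scaleC flip: scaleC_of_real)
  have Lstar: "L (star s) = cnj (L s)" if "s \<in> commutant B A" for s
    using L[OF that] index_map_star[OF E A B uv that] unfolding L_def[of "star s"]
    by (simp add: star_scaleC)
  define C where "C = (\<Sum>i<n. norm (u i) * norm (v i))"
  have C0: "C \<ge> 0" unfolding C_def by (intro sum_nonneg) auto
  have Lbound: "Re (L s) \<le> C * norm s" if "s \<in> commutant B A" for s
    using index_map_bound[of n u v s] L[OF that] complex_Re_le_cmod[of "L s"]
    by (simp add: norm_scaleC C_def)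
  have one: "1 \<in> commutant B A" by (rule n(2))
  have L1: "scalar_index A E = Re (L 1)"
    using index_map_one_eq_scalar_index[OF E As B uv] by (simp add: L_def)
  have kk: "star k * k \<in> commutant B A" and sk: "star k \<in> commutant B A" using n k by auto
  obtain m where m: "E (star k * k) = m *\<^sub>C 1"
    using conditional_expectation_commutant[OF E Bs kk] by blast
  have "star (E (star k * k)) = E (star k * k)"
    using conditional_expectation_star[OF E A B NA[OF kk]] by (simp add: star_mult star_star)
  hence "cnj m = m" unfolding m by (simp add: star_scaleC scaleC_one_inject)
  define M where "M = Re m"
  have mM: "m = of_real M" using \<open>cnj m = m\<close> by (simp add: M_def complex_eq_iff)
  define K where "K = norm k"
  have K0: "K \<ge> 0" by (simp add: K_def)
  define Q where "Q = C * (4 * K\<^sup>2 + K\<^sup>2 + 4 * K ^ 3 + 4 * K ^ 4)"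
  have Q0: "Q \<ge> 0" unfolding Q_def using C0 K0 by simp
  define \<rho> where "\<rho> = 2 * Re (L k)"
  \<comment> \<open>This range makes \<open>1 - \<epsilon> k\<close> invertible and the normalising factor \<open>1 + \<epsilon>\<^sup>2 M\<close> positive.\<close>
  define \<delta> where "\<delta> = 1 / (2 * (K + \<bar>M\<bar> + 1))"
  have \<delta>0: "\<delta> > 0" and d1: "\<delta> \<le> 1" and dK: "\<delta> * K \<le> 1/2" and dM: "\<delta> * \<bar>M\<bar> \<le> 1/2"
    using K0 by (simp_all add: \<delta>_def field_simps add_pos_nonneg)
  \<comment> \<open>\<open>P\<close> bounds all terms of second order in \<open>\<epsilon>\<close>, with \<open>Q\<close> the contribution of the remainder \<open>R\<close>.\<close>
  define P where "P = \<bar>M\<bar> * (\<bar>Re (L 1)\<bar> + \<bar>\<rho>\<bar> + Q) + Q"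
  have "\<rho> = 0"
  proof (rule linear_coefficient_zero[OF \<delta>0])
    fix \<epsilon> :: real assume ed: "\<bar>\<epsilon>\<bar> \<le> \<delta>"
    have e1: "\<bar>\<epsilon>\<bar> \<le> 1" using ed d1 by simp
    have eK: "\<bar>\<epsilon>\<bar> * K \<le> 1/2" using mult_right_mono[OF ed K0] dK by simp
    have eM: "\<bar>\<epsilon>\<bar> * \<bar>M\<bar> \<le> 1/2" using mult_right_mono[OF ed, of "\<bar>M\<bar>"] dM by simp
    have e2M: "\<bar>\<epsilon>\<^sup>2 * M\<bar> \<le> 1/2"
      using mult_mono[OF e1 eM] by (simp add: abs_mult power2_eq_square mult.assoc)
    define c where "c = 1 + \<epsilon>\<^sup>2 * M"
    have c: "c > 0" using e2M unfolding c_def by linarith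
    define g where "g = 1 - \<epsilon> *\<^sub>R k"
    have g: "g \<in> commutant B A" unfolding g_def by (intro cstar_subalgebra_diff[OF N] one NR k)
    have "norm (\<epsilon> *\<^sub>R k) < 1" using eK by (simp add: K_def)
    then obtain y where gy: "g * y = 1" "y * g = 1" and y: "y \<in> commutant B A"
      using neumann_inverse[of "\<epsilon> *\<^sub>R k"] N NR[OF k] unfolding g_def by metis
    have Egg: "E (star g * g) = c *\<^sub>R 1"
    proof -
      note e = conditional_expectationD[OF E]
      have Esk: "E (star k) = 0" using conditional_expectation_star[OF E A B NA[OF k]] Ek by simp
      have E1: "E 1 = 1" using e(4) cstar_subalgebraD(2)[OF B] by simp
      define w where "w = complex_of_real (- \<epsilon>)"
      have gw: "g = 1 + w *\<^sub>C k" unfolding g_def w_def scaleC_of_real by simp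
      have "star g * g = (1 + w *\<^sub>C k) + (w *\<^sub>C star k + (w * w) *\<^sub>C (star k * k))"
        unfolding gw by (simp add: star_add star_scaleC w_def distrib_left distrib_right
            mult_scaleC_left mult_scaleC_right scaleC_scaleC scaleC_add_right)
      hence "E (star g * g) = (1 + w *\<^sub>C E k) + (w *\<^sub>C E (star k) + (w * w) *\<^sub>C E (star k * k))"
        using e(2,3) cstar_subalgebraD[OF A] NA[OF k] NA[OF sk] NA[OF kk] E1 by simp
      also have "\<dots> = 1 + (w * w * m) *\<^sub>C 1" using Ek Esk m by (simp add: scaleC_scaleC)
      also have "w * w * m = complex_of_real (\<epsilon>\<^sup>2 * M)" by (simp add: w_def mM power2_eq_square)
      finally show ?thesis unfolding scaleC_of_real by (simp add: c_def scaleR_add_left)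
    qed
    define F where "F = (\<lambda>x. (1 / c) *\<^sub>R E (star g * x * g))"
    note pert = perturbed_expectation[OF E A B uv g y gy Egg c, folded F_def]
    have "index_finite_type B A F" unfolding index_finite_type_def using pert by blast
    hence le: "scalar_index A E \<le> scalar_index A F"
      using min unfolding minimal_conditional_expectation_def by blast
    have yy: "y * star y \<in> commutant B A" using n y by simp
    have "index_map n (\<lambda>i. c *\<^sub>R (u i * y)) (\<lambda>i. star y * v i) 1 = c *\<^sub>R index_map n u v (y * star y)"
      by (simp add: index_map_def scaleR_sum_right mult.assoc)
    also have "\<dots> = (of_real c * L (y * star y)) *\<^sub>C 1"
      unfolding L[OF yy] by (simp add: scaleC_scaleC flip: scaleC_of_real)
    finally have "complex_of_real (scalar_index A F) = of_real c * L (y * star y)"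
      using index_map_one_eq_scalar_index[OF pert(1) As B pert(2)] by (simp add: scaleC_one_inject)
    from arg_cong[OF this, of Re] have "scalar_index A F = c * Re (L (y * star y))" by simp
    with le L1 have le': "Re (L 1) \<le> c * Re (L (y * star y))" by simp
    obtain R where R: "y * star y = 1 + \<epsilon> *\<^sub>R (k + star k) + \<epsilon>\<^sup>2 *\<^sub>R R"
      "norm R \<le> 4 * K\<^sup>2 + K\<^sup>2 + 4 * K ^ 3 + 4 * K ^ 4"
      using inverse_expansion[of \<epsilon> k y] gy(1) e1 eK unfolding g_def K_def by blast
    show "0 \<le> \<epsilon> * \<rho> + \<epsilon>\<^sup>2 * P"
    proof (cases "\<epsilon> = 0")
      case False
      have skk: "k + star k \<in> commutant B A" using n k sk by simp
      have RN: "R \<in> commutant B A"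
      proof -
        have "R = (1 / \<epsilon>\<^sup>2) *\<^sub>R (y * star y - (1 + \<epsilon> *\<^sub>R (k + star k)))" using R(1) False by simp
        thus ?thesis using NR n(3)[OF one NR[OF skk]] cstar_subalgebra_diff[OF N yy] by metis
      qed
      have "L (y * star y) = L 1 + of_real \<epsilon> * (L k + cnj (L k)) + of_real (\<epsilon>\<^sup>2) * L R"
        unfolding R(1) using Lplus LR Lstar n NR one skk RN k sk by simp
      hence "Re (L (y * star y)) = Re (L 1) + \<epsilon> * \<rho> + \<epsilon>\<^sup>2 * Re (L R)"
        by (simp add: \<rho>_def flip: of_real_power)
      moreover have "Re (L R) \<le> Q"
        using Lbound[OF RN] mult_left_mono[OF R(2) C0] by (simp add: Q_def)
      ultimately have up: "Re (L (y * star y)) \<le> Re (L 1) + \<epsilon> * \<rho> + \<epsilon>\<^sup>2 * Q"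
        by (simp add: mult_left_mono)
      have "Re (L 1) \<le> c * (Re (L 1) + \<epsilon> * \<rho> + \<epsilon>\<^sup>2 * Q)"
        using le' mult_left_mono[OF up, of c] c by linarith
      hence "0 \<le> \<epsilon> * \<rho> + \<epsilon>\<^sup>2 * (M * (Re (L 1) + \<epsilon> * \<rho> + \<epsilon>\<^sup>2 * Q) + Q)"
        by (simp add: c_def algebra_simps)
      also have "M * (Re (L 1) + \<epsilon> * \<rho> + \<epsilon>\<^sup>2 * Q) + Q \<le> P"
      proof -
        have "\<bar>\<epsilon> * \<rho>\<bar> \<le> \<bar>\<rho>\<bar>" using e1 by (simp add: abs_mult mult_left_le_one_le)
        moreover have "\<epsilon>\<^sup>2 \<le> 1" using e1 by (simp add: abs_square_le_1)
        hence "\<bar>\<epsilon>\<^sup>2 * Q\<bar> \<le> Q" using Q0 by (simp add: abs_mult mult_left_le_one_le)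
        ultimately have "\<bar>Re (L 1) + \<epsilon> * \<rho> + \<epsilon>\<^sup>2 * Q\<bar> \<le> \<bar>Re (L 1)\<bar> + \<bar>\<rho>\<bar> + Q" by linarith
        hence "\<bar>M * (Re (L 1) + \<epsilon> * \<rho> + \<epsilon>\<^sup>2 * Q)\<bar> \<le> \<bar>M\<bar> * (\<bar>Re (L 1)\<bar> + \<bar>\<rho>\<bar> + Q)"
          unfolding abs_mult by (rule mult_left_mono) simp
        thus ?thesis unfolding P_def by linarith
      qed
      hence "\<epsilon>\<^sup>2 * (M * (Re (L 1) + \<epsilon> * \<rho> + \<epsilon>\<^sup>2 * Q) + Q) \<le> \<epsilon>\<^sup>2 * P"
        by (rule mult_left_mono) simp
      finally show ?thesis by simp
    qed simp
  qed
  thus ?thesis by (simp add: \<rho>_def L_def)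
qed

text \<open>The characterisation of minimality.  Splitting \<open>s\<close> into the scalar \<open>E(s)\<close> and an element \<open>k\<close> of the
  kernel of \<open>E\<close> reduces it to \<open>\<theta>(k) = 0\<close>; the imaginary part of that comes from \<open>\<i> k\<close>.\<close>

lemma minimal_index_map:
  assumes Bs: "simple_cstar B" and As: "simple_cstar A"
    and min: "minimal_conditional_expectation B A E" and uv: "quasi_basis A E n u v"
    and s: "s \<in> commutant B A"
  shows "index_map n u v s = scalar_index A E *\<^sub>R E s"
proof -
  have A: "cstar_subalgebra A" and B: "cstar_subalgebra B" using As Bs by (auto simp: simple_cstar_def)
  have E: "conditional_expectation B A E"
    using min by (auto simp: minimal_conditional_expectation_def index_finite_type_def)
  have N: "cstar_subalgebra (commutant B A)"
    using cstar_subalgebra_commutant[OF A] cstar_subalgebraD(6)[OF B] by blast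
  note n = cstar_subalgebraD[OF N] and e = conditional_expectationD[OF E]
  obtain c where c: "E s = c *\<^sub>C 1" using conditional_expectation_commutant[OF E Bs s] by blast
  define k where "k = s - c *\<^sub>C 1"
  have k: "k \<in> commutant B A" unfolding k_def by (intro cstar_subalgebra_diff[OF N] n s)
  have kA: "k \<in> A" using k by (simp add: commutant_def)
  have "E (c *\<^sub>C 1) = c *\<^sub>C 1" using e(4) cstar_subalgebraD(2,5)[OF B] by simp
  hence Ek: "E k = 0"
    using conditional_expectation_diff[OF E A] s cstar_subalgebraD(2,5)[OF A] c
    by (simp add: k_def commutant_def)
  have ik: "\<i> *\<^sub>C k \<in> commutant B A" "E (\<i> *\<^sub>C k) = 0" using n(5) k e(3)[OF kA] Ek by auto
  define l where "l = scalar_of (index_map n u v k)"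
  have l: "index_map n u v k = l *\<^sub>C 1" unfolding l_def by (rule index_map_scalar[OF E As uv k])
  have "Re l = 0" unfolding l_def by (rule index_map_kernel_real_part[OF Bs As min uv k Ek])
  moreover have "Re (\<i> * l) = 0"
    using index_map_kernel_real_part[OF Bs As min uv ik]
    by (simp only: index_map_scaleC l scaleC_scaleC scalar_of_scaleC_one)
  ultimately have "l = 0" by (simp add: complex_eq_iff)
  hence "index_map n u v k = 0" using l by simp
  moreover have "s = k + c *\<^sub>C 1" by (simp add: k_def)
  ultimately have "index_map n u v s = c *\<^sub>C index_map n u v 1"
    using index_map_add[of n u v k "c *\<^sub>C 1"] by (simp add: index_map_scaleC)
  thus ?thesis
    unfolding index_map_one_eq_scalar_index[OF E As B uv] c
    by (simp add: scaleC_scaleC mult.commute flip: scaleC_of_real)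
qed

section \<open>The basic construction\<close>

lemma basic_constructionD:
  assumes "basic_construction A E e C"
  shows "cstar_subalgebra C" "A \<subseteq> C" "e \<in> C"
    "\<exists>\<pi>. faithful_module_rep A E C \<pi> \<and> (\<forall>a\<in>A. \<forall>x\<in>A. \<pi> a x = a * x) \<and> (\<forall>x\<in>A. \<pi> e x = E x)"
  using assms unfolding basic_construction_def by - (elim conjE, assumption)+

lemma faithful_module_repD:
  assumes "faithful_module_rep A E C \<pi>"
  shows "\<And>z x. z \<in> C \<Longrightarrow> x \<in> A \<Longrightarrow> \<pi> z x \<in> A"
    and "\<And>z x y. z \<in> C \<Longrightarrow> x \<in> A \<Longrightarrow> y \<in> A \<Longrightarrow> E (star (\<pi> z x) * y) = E (star x * \<pi> (star z) y)"
    and "\<And>z w x. z \<in> C \<Longrightarrow> w \<in> C \<Longrightarrow> x \<in> A \<Longrightarrow> \<pi> (z + w) x = \<pi> z x + \<pi> w x"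
    and "\<And>z w x. z \<in> C \<Longrightarrow> w \<in> C \<Longrightarrow> x \<in> A \<Longrightarrow> \<pi> (z * w) x = \<pi> z (\<pi> w x)"
    and "\<And>c z x. z \<in> C \<Longrightarrow> x \<in> A \<Longrightarrow> \<pi> (c *\<^sub>C z) x = c *\<^sub>C \<pi> z x"
    and "\<And>z. z \<in> C \<Longrightarrow> (\<And>x. x \<in> A \<Longrightarrow> \<pi> z x = 0) \<Longrightarrow> z = 0"
  using assms unfolding faithful_module_rep_def by simp_all

text \<open>Each relation is an identity of operators on the module \<open>A\<close>, checked on vectors and pulled back along the
  faithful representation.  The quasi-basis makes the inner product \<open>E(x* y)\<close> nondegenerate, which
  gives the self-adjointness of \<open>e\<close> and, through adjoints, right \<open>B\<close>-linearity of every operator in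
  \<open>C\<close>; the element that absorbs \<open>z\<close> is the value of \<open>z\<close> at the vector \<open>1\<close>.\<close>

lemma basic_construction_relations:
  assumes bc: "basic_construction A E e C" and E: "conditional_expectation B A E"
    and A: "cstar_subalgebra A" and B: "cstar_subalgebra B" and BA: "B \<subseteq> A"
    and uv: "quasi_basis A E n u v"
  shows jones_compression: "\<And>x. x \<in> A \<Longrightarrow> e * x * e = E x * e"
    and jones_commutes: "\<And>b. b \<in> B \<Longrightarrow> e * b = b * e"
    and jones_selfadjoint: "star e = e"
    and jones_resolution: "(\<Sum>i<n. u i * e * v i) = 1"
    and jones_separating: "\<And>a. a \<in> A \<Longrightarrow> a * e = 0 \<Longrightarrow> a = 0"
    and jones_absorption: "\<And>z. z \<in> C \<Longrightarrow> \<exists>p\<in>A. z * e = p * e"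
proof -
  have C: "cstar_subalgebra C" and AC: "A \<subseteq> C" and eC: "e \<in> C"
    using basic_constructionD[OF bc] by auto
  obtain \<pi> where \<pi>: "faithful_module_rep A E C \<pi>" and \<pi>a: "\<And>a x. a \<in> A \<Longrightarrow> x \<in> A \<Longrightarrow> \<pi> a x = a * x"
    and \<pi>e: "\<And>x. x \<in> A \<Longrightarrow> \<pi> e x = E x"
    using basic_constructionD(4)[OF bc] by blast
  note mem = faithful_module_repD(1)[OF \<pi>] and adj = faithful_module_repD(2)[OF \<pi>]
    and \<pi>plus = faithful_module_repD(3)[OF \<pi>] and \<pi>mult = faithful_module_repD(4)[OF \<pi>]
    and \<pi>scale = faithful_module_repD(5)[OF \<pi>] and faith = faithful_module_repD(6)[OF \<pi>]
  note ce = conditional_expectationD[OF E] and a = cstar_subalgebraD[OF A] and b = cstar_subalgebraD[OF B]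
    and c = cstar_subalgebraD[OF C] and q = quasi_basisD[OF uv]
  have BA': "x \<in> A" if "x \<in> B" for x using BA that by auto
  have AC': "x \<in> C" if "x \<in> A" for x using AC that by auto
  have \<pi>eq: "z = w" if "z \<in> C" "w \<in> C" "\<And>x. x \<in> A \<Longrightarrow> \<pi> z x = \<pi> w x" for z w
  proof -
    have "z + (-1) *\<^sub>C w = 0"
    proof (rule faith)
      show "z + (-1) *\<^sub>C w \<in> C" by (intro c that)
      show "\<pi> (z + (-1) *\<^sub>C w) x = 0" if "x \<in> A" for x
        unfolding \<pi>plus[OF \<open>z \<in> C\<close> c(5)[OF \<open>w \<in> C\<close>] that] \<pi>scale[OF \<open>w \<in> C\<close> that]
        using \<open>\<And>x. x \<in> A \<Longrightarrow> \<pi> z x = \<pi> w x\<close>[OF that] by (simp add: scaleC_minus_one)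
    qed
    thus ?thesis by (simp add: scaleC_minus_one)
  qed
  have nondeg: "x = y" if "x \<in> A" "y \<in> A" "\<And>z. z \<in> A \<Longrightarrow> E (star z * x) = E (star z * y)" for x y
  proof -
    have "x = (\<Sum>i<n. u i * E (star (star (v i)) * x))" using q(3)[OF that(1)] by (simp add: star_star)
    also have "\<dots> = (\<Sum>i<n. u i * E (star (star (v i)) * y))"
      using that(3) a(6) q(2) by (intro sum.cong) auto
    also have "\<dots> = y" using q(3)[OF that(2)] by (simp add: star_star)
    finally show ?thesis .
  qed
  show comp: "e * x * e = E x * e" if x: "x \<in> A" for x
  proof (rule \<pi>eq)
    fix y assume y: "y \<in> A"
    have "\<pi> (e * x * e) y = E (x * E y)"
      using x y ce(1) a c eC AC' BA' by (simp add: \<pi>mult \<pi>a \<pi>e)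
    moreover have "\<pi> (E x * e) y = E x * E y"
      using x y ce(1) a c eC AC' BA' by (simp add: \<pi>mult \<pi>a \<pi>e)
    ultimately show "\<pi> (e * x * e) y = \<pi> (E x * e) y" using ce(6)[OF ce(1)[OF y] x] by simp
  qed (use x c eC AC' BA' ce(1) in auto)
  show "e * t = t * e" if t: "t \<in> B" for t
  proof (rule \<pi>eq)
    fix y assume y: "y \<in> A"
    show "\<pi> (e * t) y = \<pi> (t * e) y"
      using t y ce(1) a c eC AC' BA' ce(5)[OF t y] by (simp add: \<pi>mult \<pi>a \<pi>e)
  qed (use t c eC AC' BA' in auto)
  show "star e = e"
  proof (rule \<pi>eq)
    fix y assume y: "y \<in> A"
    show "\<pi> (star e) y = \<pi> e y"
    proof (rule nondeg)
      fix x assume x: "x \<in> A"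
      have "E (star x * \<pi> (star e) y) = E (star (E x) * y)" using adj[OF eC x y] \<pi>e[OF x] by simp
      also have "\<dots> = star (E x) * E y" using ce(5)[OF b(6)[OF ce(1)[OF x]] y] .
      also have "\<dots> = E (star x) * E y" using conditional_expectation_star[OF E A B x] by simp
      also have "\<dots> = E (star x * \<pi> e y)" using ce(6)[OF ce(1)[OF y] a(6)[OF x]] \<pi>e[OF y] by simp
      finally show "E (star x * \<pi> (star e) y) = E (star x * \<pi> e y)" .
    qed (use mem c eC y in auto)
  qed (use c eC in auto)
  have \<pi>zero: "\<pi> 0 x = 0" if "x \<in> A" for x using \<pi>scale[OF c(2) that, of 0] by simp
  have mid: "u i * e * v i \<in> C" if "i < n" for i using that q(1,2) AC' eC c by simp
  have sums: "\<pi> (\<Sum>i<m. u i * e * v i) y = (\<Sum>i<m. u i * E (v i * y))" if "m \<le> n" "y \<in> A" for m y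
    using that(1)
  proof (induction m)
    case (Suc m)
    have "(\<Sum>i<m. u i * e * v i) \<in> C" using Suc mid by (intro cstar_subalgebra_sum[OF C]) auto
    moreover have "\<pi> (u m * e * v m) y = u m * E (v m * y)"
      using Suc that(2) q(1,2)[of m] ce(1) a c eC AC' BA' by (simp add: \<pi>mult \<pi>a \<pi>e)
    ultimately show ?case using Suc mid[of m] that(2) by (simp add: \<pi>plus)
  qed (use \<pi>zero that(2) in simp)
  show "(\<Sum>i<n. u i * e * v i) = 1"
  proof (rule \<pi>eq)
    fix y assume "y \<in> A"
    thus "\<pi> (\<Sum>i<n. u i * e * v i) y = \<pi> 1 y" using sums[of n y] q(3) \<pi>a[OF a(2)] by simp
  qed (auto intro!: cstar_subalgebra_sum[OF C] mid c(2))
  have E1: "E 1 = 1" using ce(4) b(2) by simp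
  show "x = 0" if "x \<in> A" "x * e = 0" for x
  proof -
    have "\<pi> (x * e) 1 = x * E 1" using that(1) a(2) AC' eC E1 by (simp add: \<pi>mult \<pi>a \<pi>e)
    thus ?thesis using that(2) \<pi>zero[OF a(2)] E1 by simp
  qed
  show "\<exists>p\<in>A. z * e = p * e" if z: "z \<in> C" for z
  proof (intro bexI)
    have module: "\<pi> z t = \<pi> z 1 * t" if t: "t \<in> B" for t
    proof (rule nondeg)
      fix y assume y: "y \<in> A"
      have m: "star (\<pi> (star z) y) \<in> A" using mem a c z y by simp
      have ad: "E (star y * \<pi> z x) = E (star (\<pi> (star z) y) * x)" if "x \<in> A" for x
        using adj[OF c(6)[OF z] y that] by (simp add: star_star)
      have "E (star y * \<pi> z t) = E (star (\<pi> (star z) y) * 1) * t"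
        using ad[OF BA'[OF t]] ce(6)[OF t m] by simp
      also have "\<dots> = E (star y * \<pi> z 1) * t" using ad[OF a(2)] by simp
      also have "\<dots> = E (star y * (\<pi> z 1 * t))"
        using ce(6)[OF t, of "star y * \<pi> z 1"] mem[OF z a(2)] a y by (simp add: mult.assoc)
      finally show "E (star y * \<pi> z t) = E (star y * (\<pi> z 1 * t))" .
    qed (use mem z a t BA' in auto)
    show p: "\<pi> z 1 \<in> A" using mem z a(2) by simp
    show "z * e = \<pi> z 1 * e"
    proof (rule \<pi>eq)
      fix y assume y: "y \<in> A"
      have "\<pi> (z * e) y = \<pi> z (E y)" using z y eC by (simp add: \<pi>mult \<pi>e)
      also have "\<dots> = \<pi> z 1 * E y" by (rule module[OF ce(1)[OF y]])
      also have "\<dots> = \<pi> (\<pi> z 1 * e) y"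
        using p y eC AC' BA' ce(1) by (simp add: \<pi>mult \<pi>a \<pi>e)
      finally show "\<pi> (z * e) y = \<pi> (\<pi> z 1 * e) y" .
    qed (use z p eC AC' c in auto)
  qed
qed

text \<open>Multiply \<open>z\<close> into the resolution of the unit \<open>\<Sum>i. u\<^sub>i e v\<^sub>i = 1\<close>.  Thus the linear
  span of \<open>A e A\<close> is all of \<open>C\<close>, and the values on \<open>A e A\<close> determine the dual expectation algebraically.\<close>

lemma basic_construction_expansion:
  assumes bc: "basic_construction A E e C" and E: "conditional_expectation B A E"
    and A: "cstar_subalgebra A" and B: "cstar_subalgebra B" and BA: "B \<subseteq> A"
    and uv: "quasi_basis A E n u v" and z: "z \<in> C"
  obtains p where "\<And>i. i < n \<Longrightarrow> p i \<in> A" "\<And>i. i < n \<Longrightarrow> z * u i * e = p i * e"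
    "z = (\<Sum>i<n. p i * e * v i)"
proof -
  note rel = basic_construction_relations[OF bc E A B BA uv]
  have C: "cstar_subalgebra C" and AC: "A \<subseteq> C" using basic_constructionD[OF bc] by auto
  have "\<exists>p. p \<in> A \<and> z * u i * e = p * e" if "i < n" for i
    using rel(6)[OF cstar_subalgebraD(4)[OF C z subsetD[OF AC quasi_basisD(1)[OF uv that]]]] by blast
  hence "\<forall>i. \<exists>p. i < n \<longrightarrow> p \<in> A \<and> z * u i * e = p * e" by blast
  from choice[OF this] obtain p where p: "p i \<in> A" "z * u i * e = p i * e" if "i < n" for i
    by blast
  have "z = z * (\<Sum>i<n. u i * e * v i)" using rel(4) by simp
  also have "\<dots> = (\<Sum>i<n. (z * u i * e) * v i)" by (simp add: sum_distrib_left mult.assoc)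
  also have "\<dots> = (\<Sum>i<n. p i * e * v i)" using p by (intro sum.cong) auto
  finally show ?thesis using that p by blast
qed

lemma dual_conditional_expectationD:
  assumes "dual_conditional_expectation A e C \<tau> F"
  shows "conditional_expectation A C F"
    and "\<And>x y. x \<in> A \<Longrightarrow> y \<in> A \<Longrightarrow> F (x * e * y) = \<tau> *\<^sub>R (x * y)"
  using assms unfolding dual_conditional_expectation_def by auto

lemma dual_expectation_sum:
  assumes F: "dual_conditional_expectation A e C \<tau> F" and A: "cstar_subalgebra A"
    and C: "cstar_subalgebra C" and AC: "A \<subseteq> C" and eC: "e \<in> C"
    and x: "\<And>i. i < n \<Longrightarrow> x i \<in> A" and y: "\<And>i. i < n \<Longrightarrow> y i \<in> A"
  shows "F (\<Sum>i<n. x i * e * y i) = \<tau> *\<^sub>R (\<Sum>i<n. x i * y i)"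
proof -
  have "F (\<Sum>i<n. x i * e * y i) = (\<Sum>i<n. F (x i * e * y i))"
    using x y subsetD[OF AC] eC cstar_subalgebraD(4)[OF C]
    by (intro conditional_expectation_sum[OF dual_conditional_expectationD(1)[OF F] C A]) auto
  also have "\<dots> = (\<Sum>i<n. \<tau> *\<^sub>R (x i * y i))"
    using x y dual_conditional_expectationD(2)[OF F] by (intro sum.cong) auto
  finally show ?thesis by (simp add: scaleR_sum_right)
qed

text \<open>This is what allows the analysis of a basic construction to be repeated one storey higher in the tower.\<close>

lemma dual_quasi_basis:
  assumes bc: "basic_construction A E e C" and E: "conditional_expectation B A E"
    and A: "cstar_subalgebra A" and B: "cstar_subalgebra B" and BA: "B \<subseteq> A"
    and uv: "quasi_basis A E n u v" and F: "dual_conditional_expectation A e C \<tau> F" and \<tau>: "\<tau> \<noteq> 0"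
  shows "quasi_basis C F n (\<lambda>i. u i * e) (\<lambda>i. (1 / \<tau>) *\<^sub>R (e * v i))"
proof -
  note rel = basic_construction_relations[OF bc E A B BA uv]
  have C: "cstar_subalgebra C" and AC: "A \<subseteq> C" and eC: "e \<in> C"
    using basic_constructionD[OF bc] by auto
  have AC': "x \<in> C" if "x \<in> A" for x using AC that by auto
  have BA': "x \<in> A" if "x \<in> B" for x using BA that by auto
  have CR: "r *\<^sub>R x \<in> C" if "x \<in> C" for r x
    using cstar_subalgebraD(5)[OF C that, of "complex_of_real r"] by (simp add: scaleC_of_real)
  note f = conditional_expectationD[OF dual_conditional_expectationD(1)[OF F]]
  have FR: "F (r *\<^sub>R x) = r *\<^sub>R F x" if "x \<in> C" for r x
    using f(3)[OF that, of "complex_of_real r"] by (simp add: scaleC_of_real)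
  note fe = dual_conditional_expectationD(2)[OF F] and c = cstar_subalgebraD[OF C]
    and a = cstar_subalgebraD[OF A] and q = quasi_basisD[OF uv] and ce = conditional_expectationD[OF E]
  have "(\<Sum>i<n. u i * e * F ((1 / \<tau>) *\<^sub>R (e * v i) * x)) = x"
    "(\<Sum>i<n. F (x * (u i * e)) * ((1 / \<tau>) *\<^sub>R (e * v i))) = x" if x: "x \<in> C" for x
  proof -
    obtain p where p: "\<And>i. i < n \<Longrightarrow> p i \<in> A" "\<And>i. i < n \<Longrightarrow> x * u i * e = p i * e"
      "x = (\<Sum>i<n. p i * e * v i)"
      by (rule basic_construction_expansion[OF bc E A B BA uv x]) blast
    have 1: "u i * e * F ((1 / \<tau>) *\<^sub>R (e * v i) * x) = (\<Sum>j<n. u i * E (v i * p j) * (e * v j))"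
      if i: "i < n" for i
    proof -
      have m: "E (v i * p j) \<in> B" if "j < n" for j using ce(1) a q(2)[OF i] p(1)[OF that] by simp
      have "e * v i * x = (\<Sum>j<n. (e * (v i * p j) * e) * v j)"
        by (subst p(3)) (simp add: sum_distrib_left mult.assoc)
      also have "\<dots> = (\<Sum>j<n. E (v i * p j) * e * v j)"
        using rel(1) a q(2)[OF i] p(1) by (intro sum.cong) auto
      finally have "F (e * v i * x) = \<tau> *\<^sub>R (\<Sum>j<n. E (v i * p j) * v j)"
        using dual_expectation_sum[OF F A C AC eC, of n "\<lambda>j. E (v i * p j)" v] m BA' q(2) by simp
      moreover have "e * v i * x \<in> C" using eC AC' q(2)[OF i] x c by simp
      ultimately have "F ((1 / \<tau>) *\<^sub>R (e * v i) * x) = (\<Sum>j<n. E (v i * p j) * v j)"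
        using FR \<tau> by simp
      hence "u i * e * F ((1 / \<tau>) *\<^sub>R (e * v i) * x) = (\<Sum>j<n. u i * (e * E (v i * p j)) * v j)"
        by (simp add: sum_distrib_left mult.assoc)
      also have "\<dots> = (\<Sum>j<n. u i * (E (v i * p j) * e) * v j)"
        using rel(2) m by (intro sum.cong) auto
      finally show ?thesis by (simp add: mult.assoc)
    qed
    have "(\<Sum>i<n. u i * e * F ((1 / \<tau>) *\<^sub>R (e * v i) * x))
      = (\<Sum>i<n. \<Sum>j<n. u i * E (v i * p j) * (e * v j))" using 1 by (intro sum.cong) auto
    also have "\<dots> = (\<Sum>j<n. (\<Sum>i<n. u i * E (v i * p j)) * (e * v j))"
      by (subst sum.swap) (simp add: sum_distrib_right)
    also have "\<dots> = (\<Sum>j<n. p j * (e * v j))" using q(3) p(1) by (intro sum.cong) auto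
    finally show "(\<Sum>i<n. u i * e * F ((1 / \<tau>) *\<^sub>R (e * v i) * x)) = x"
      using p(3) by (simp add: mult.assoc)
    have "F (x * (u i * e)) * ((1 / \<tau>) *\<^sub>R (e * v i)) = p i * e * v i" if "i < n" for i
      using fe[OF p(1)[OF that] a(2)] p(2)[OF that] \<tau> by (simp add: mult.assoc)
    hence "(\<Sum>i<n. F (x * (u i * e)) * ((1 / \<tau>) *\<^sub>R (e * v i))) = (\<Sum>i<n. p i * e * v i)"
      by (intro sum.cong) auto
    thus "(\<Sum>i<n. F (x * (u i * e)) * ((1 / \<tau>) *\<^sub>R (e * v i))) = x" using p(3) by simp
  qed
  thus ?thesis unfolding quasi_basis_def using AC' eC c q(1,2) CR by simp
qed

text \<open>Write \<open>w = \<Sum>i. p\<^sub>i e v\<^sub>i\<close>.  Compressing by \<open>e\<close> on the right turns it into \<open>t = \<Sum>i. p\<^sub>i E(v\<^sub>i)\<close>, and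
  applying \<open>E \<circ> F\<close> to \<open>e x w = \<Sum>i. E(x p\<^sub>i) e v\<^sub>i\<close> yields the same coefficients.  That \<open>t\<close> commutes with \<open>B\<close> follows
  because \<open>a e = 0\<close> implies \<open>a = 0\<close> in \<open>A\<close>.\<close>

lemma basic_construction_symbol:
  assumes bc: "basic_construction A E e C" and E: "conditional_expectation B A E"
    and A: "cstar_subalgebra A" and B: "cstar_subalgebra B" and BA: "B \<subseteq> A"
    and uv: "quasi_basis A E n u v" and F: "dual_conditional_expectation A e C \<tau> F"
    and w: "w \<in> commutant B C"
  obtains t where "t \<in> commutant B A" "w * e = t * e"
    "\<And>x. x \<in> A \<Longrightarrow> E (F (e * x * w)) = \<tau> *\<^sub>R E (x * t)"
proof -
  note rel = basic_construction_relations[OF bc E A B BA uv]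
  have C: "cstar_subalgebra C" and AC: "A \<subseteq> C" and eC: "e \<in> C"
    using basic_constructionD[OF bc] by auto
  have BA': "x \<in> A" if "x \<in> B" for x using BA that by auto
  note a = cstar_subalgebraD[OF A] and q = quasi_basisD[OF uv] and ce = conditional_expectationD[OF E]
  have wC: "w \<in> C" and wB: "\<And>b. b \<in> B \<Longrightarrow> b * w = w * b" using w unfolding commutant_def by auto
  obtain p where p: "\<And>i. i < n \<Longrightarrow> p i \<in> A" "w = (\<Sum>i<n. p i * e * v i)"
    by (rule basic_construction_expansion[OF bc E A B BA uv wC]) blast
  define t where "t = (\<Sum>i<n. p i * E (v i))"
  have tA: "t \<in> A"
    unfolding t_def using p(1) q(2) ce(1) BA' a by (intro cstar_subalgebra_sum[OF A]) auto
  have we: "w * e = t * e"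
  proof -
    have "w * e = (\<Sum>i<n. p i * (e * v i * e))"
      by (subst p(2)) (simp add: sum_distrib_right mult.assoc)
    also have "\<dots> = (\<Sum>i<n. p i * (E (v i) * e))" using rel(1) q(2) by (intro sum.cong) auto
    finally show ?thesis by (simp add: t_def sum_distrib_right mult.assoc)
  qed
  have "b * t = t * b" if b: "b \<in> B" for b
  proof -
    have "b * t * e = b * (w * e)" by (simp add: we mult.assoc)
    also have "\<dots> = w * (b * e)" using wB[OF b] by (simp flip: mult.assoc)
    also have "\<dots> = (w * e) * b" using rel(2)[OF b] by (simp add: mult.assoc)
    also have "\<dots> = t * b * e" using rel(2)[OF b] by (simp add: we mult.assoc)
    finally have "(b * t - t * b) * e = 0" by (simp add: left_diff_distrib)
    moreover have "b * t - t * b \<in> A"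
      using cstar_subalgebra_diff[OF A] a(4) tA BA'[OF b] by simp
    ultimately show ?thesis using rel(5) by fastforce
  qed
  hence t: "t \<in> commutant B A" using tA unfolding commutant_def by auto
  have "E (F (e * x * w)) = \<tau> *\<^sub>R E (x * t)" if x: "x \<in> A" for x
  proof -
    have m: "E (x * p i) \<in> B" if "i < n" for i using ce(1) a x p(1)[OF that] by simp
    have "e * x * w = (\<Sum>i<n. e * (x * p i) * e * v i)"
      by (subst p(2)) (simp add: sum_distrib_left mult.assoc)
    also have "\<dots> = (\<Sum>i<n. E (x * p i) * e * v i)" using rel(1) a x p(1) by (intro sum.cong) auto
    finally have "F (e * x * w) = \<tau> *\<^sub>R (\<Sum>i<n. E (x * p i) * v i)"
      using dual_expectation_sum[OF F A C AC eC, of n "\<lambda>i. E (x * p i)" v] m BA' q(2) by simp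
    moreover have "(\<Sum>i<n. E (x * p i) * v i) \<in> A"
      using m BA' q(2) a(4) by (intro cstar_subalgebra_sum[OF A]) auto
    ultimately have "E (F (e * x * w)) = \<tau> *\<^sub>R E (\<Sum>i<n. E (x * p i) * v i)"
      using ce(3)[of _ "complex_of_real \<tau>"] by (simp add: scaleC_of_real)
    also have "E (\<Sum>i<n. E (x * p i) * v i) = (\<Sum>i<n. E (E (x * p i) * v i))"
      using m BA' q(2) a(4) by (intro conditional_expectation_sum[OF E A B]) auto
    also have "\<dots> = (\<Sum>i<n. E (x * (p i * E (v i))))"
    proof (intro sum.cong refl)
      fix i assume "i \<in> {..<n}"
      hence i: "i < n" by simp
      have "E (E (x * p i) * v i) = E (x * p i) * E (v i)" by (rule ce(5)[OF m[OF i] q(2)[OF i]])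
      also have "\<dots> = E (x * p i * E (v i))"
        using ce(6)[OF ce(1)[OF q(2)[OF i]], of "x * p i"] a(4) x p(1)[OF i] by simp
      finally show "E (E (x * p i) * v i) = E (x * (p i * E (v i)))" by (simp add: mult.assoc)
    qed
    also have "\<dots> = E (\<Sum>i<n. x * (p i * E (v i)))"
      using x p(1) q(2) ce(1) BA' a(4) by (intro conditional_expectation_sum[OF E A B, symmetric]) auto
    also have "(\<Sum>i<n. x * (p i * E (v i))) = x * t" by (simp add: t_def sum_distrib_left)
    finally show ?thesis .
  qed
  with that t we show ?thesis by blast
qed

text \<open>Since \<open>t\<close> commutes with \<open>A\<close>, it can be moved next to \<open>e\<close> in the resolution of the unit, giving
  \<open>t = \<Sum>i. u\<^sub>i s e v\<^sub>i\<close>.\<close>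
lemma dual_expectation_of_symbol:
  assumes bc: "basic_construction A E e C" and E: "conditional_expectation B A E"
    and A: "cstar_subalgebra A" and B: "cstar_subalgebra B" and BA: "B \<subseteq> A"
    and uv: "quasi_basis A E n u v" and F: "dual_conditional_expectation A e C \<tau> F"
    and t: "t \<in> commutant A C" and s: "s \<in> A" and te: "t * e = s * e"
  shows "F t = \<tau> *\<^sub>R index_map n u v s"
proof -
  note rel = basic_construction_relations[OF bc E A B BA uv]
  have C: "cstar_subalgebra C" and AC: "A \<subseteq> C" and eC: "e \<in> C"
    using basic_constructionD[OF bc] by auto
  note q = quasi_basisD[OF uv]
  have tA: "\<And>a. a \<in> A \<Longrightarrow> a * t = t * a" using t unfolding commutant_def by auto
  have "t = t * (\<Sum>i<n. u i * e * v i)" using rel(4) by simp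
  also have "\<dots> = (\<Sum>i<n. t * u i * e * v i)" by (simp add: sum_distrib_left mult.assoc)
  also have "\<dots> = (\<Sum>i<n. (u i * s) * e * v i)"
  proof (intro sum.cong refl)
    fix i assume "i \<in> {..<n}"
    hence "t * u i = u i * t" using tA[OF q(1)] by simp
    hence "t * u i * e * v i = u i * (t * e) * v i" by (simp only: mult.assoc[symmetric])
    thus "t * u i * e * v i = (u i * s) * e * v i" unfolding te by (simp add: mult.assoc)
  qed
  finally show ?thesis
    using dual_expectation_sum[OF F A C AC eC, of n "\<lambda>i. u i * s" v] q(1,2) s cstar_subalgebraD(4)[OF A]
    by (simp add: index_map_def)
qed

section \<open>Comparison of the two functionals\<close>

theorem proposition3p10:
  fixes B A A1 A2 :: "'a::unital_cstar_algebra set"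
    and E0 E1 E2 :: "'a \<Rightarrow> 'a" and e1 e2 :: 'a and \<tau> d :: real
    and tr \<epsilon> \<epsilon>_NV :: "'a \<Rightarrow> complex"
  assumes "simple_cstar B" and "simple_cstar A" and "B \<subseteq> A"
    and "\<exists>E. index_finite_type B A E"
    and "minimal_conditional_expectation B A E0"
    and "\<tau> = inverse (scalar_index A E0)"
    and "basic_construction A E0 e1 A1"
    and "dual_conditional_expectation A e1 A1 \<tau> E1"
    and "basic_construction A1 E1 e2 A2"
    and "dual_conditional_expectation A1 e2 A2 \<tau> E2"
    and "tr = tower_trace E0 E1 E2"
    and "d = two_norm tr (watatani_index (commutant A A1) E1)"
    and "\<And>w. w \<in> commutant A A2 \<Longrightarrow> \<epsilon> w = of_real (inverse \<tau>) * trace_inner tr e2 w"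
    and "\<And>w. w \<in> commutant A A2 \<Longrightarrow> \<epsilon>_NV w = nv_pairing d \<tau> e1 e2 tr 1 w"
  shows "\<forall>w \<in> commutant A A2. \<epsilon>_NV w = of_real d * \<epsilon> w"
proof
  fix w assume w: "w \<in> commutant A A2"
  have eps: "\<epsilon> w = of_real (inverse \<tau>) * tr (star e2 * w)"
    using assms(13)[OF w] by (simp add: trace_inner_def)
  have epsNV: "\<epsilon>_NV w = of_real (d / \<tau>\<^sup>2) * tr (e2 * e1 * w)"
    using assms(14)[OF w] by (simp add: nv_pairing_def)
  show "\<epsilon>_NV w = of_real d * \<epsilon> w"
  \<comment> \<open>If \<open>\<tau> = 0\<close>, both prefactors vanish since \<open>x / 0 = 0\<close>.\<close>
  proof (cases "\<tau> = 0")
    case True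
    thus ?thesis using eps epsNV by simp
  next
    case \<tau>: False
    have A: "cstar_subalgebra A" and B: "cstar_subalgebra B"
      using assms(1,2) by (auto simp: simple_cstar_def)
    have A1: "cstar_subalgebra A1" and AA1: "A \<subseteq> A1" and e1: "e1 \<in> A1"
      using basic_constructionD[OF assms(7)] by auto
    obtain n u v where E0: "conditional_expectation B A E0" and uv: "quasi_basis A E0 n u v"
      using assms(5) by (auto simp: minimal_conditional_expectation_def index_finite_type_def)
    note E1 = dual_conditional_expectationD(1)[OF assms(8)]
    note q1 = dual_quasi_basis[OF assms(7) E0 A B assms(3) uv assms(8) \<tau>]
    have e2: "star e2 = e2" by (rule jones_selfadjoint[OF assms(9) E1 A1 A AA1 q1])
    \<comment> \<open>Descend from \<open>A' \<inter> A\<^sub>2\<close> to \<open>A' \<inter> A\<^sub>1\<close> and from there to \<open>B' \<inter> A\<close>.\<close>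
    obtain t where t: "t \<in> commutant A A1" "w * e2 = t * e2"
      "\<And>x. x \<in> A1 \<Longrightarrow> E1 (E2 (e2 * x * w)) = \<tau> *\<^sub>R E1 (x * t)"
      using basic_construction_symbol[OF assms(9) E1 A1 A AA1 q1 assms(10) w] by blast
    have tB: "t \<in> commutant B A1" using t(1) assms(3) by (auto simp: commutant_def)
    obtain s where s: "s \<in> commutant B A" "t * e1 = s * e1"
      "\<And>x. x \<in> A \<Longrightarrow> E0 (E1 (e1 * x * t)) = \<tau> *\<^sub>R E0 (x * s)"
      using basic_construction_symbol[OF assms(7) E0 A B assms(3) uv assms(8) tB] by blast
    have sA: "s \<in> A" and tA1: "t \<in> A1" using s(1) t(1) by (auto simp: commutant_def)
    obtain c where c: "E0 s = c *\<^sub>C 1"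
      using conditional_expectation_commutant[OF E0 assms(1) s(1)] by blast
    have E0R: "E0 (\<tau> *\<^sub>R x) = \<tau> *\<^sub>R E0 x" if "x \<in> A" for x
      using conditional_expectationD(3)[OF E0 that, of "complex_of_real \<tau>"] by (simp add: scaleC_of_real)
    have E1A: "E1 x \<in> A" if "x \<in> A1" for x using conditional_expectationD(1)[OF E1 that] .
    have "E0 (E1 (E2 (e2 * e1 * w))) = \<tau> *\<^sub>R E0 (E1 (e1 * t))"
      using t(3)[OF e1] E0R[OF E1A] cstar_subalgebraD(4)[OF A1 e1 tA1] by simp
    also have "E0 (E1 (e1 * t)) = \<tau> *\<^sub>R E0 s" using s(3)[of 1] cstar_subalgebraD(2)[OF A] by simp
    finally have "E0 (E1 (E2 (e2 * e1 * w))) = (of_real (\<tau>\<^sup>2) * c) *\<^sub>C 1"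
      unfolding c by (simp add: power2_eq_square scaleC_scaleC mult.assoc flip: scaleC_of_real)
    hence tr1: "tr (e2 * e1 * w) = of_real (\<tau>\<^sup>2) * c"
      unfolding assms(11) tower_trace_def by (simp only: scalar_of_scaleC_one)
    have "E1 t = \<tau> *\<^sub>R index_map n u v s"
      by (rule dual_expectation_of_symbol[OF assms(7) E0 A B assms(3) uv assms(8) t(1) sA s(2)])
    also have "\<dots> = E0 s"
      using minimal_index_map[OF assms(1,2,5) uv s(1)] assms(6) \<tau> by simp
    finally have E1t: "E1 t = E0 s" .
    have "E0 (E0 s) = E0 s" using conditional_expectationD(1,4)[OF E0] sA by simp
    hence "E0 (E1 (E2 (e2 * w))) = \<tau> *\<^sub>R E0 s"
      using t(3)[OF cstar_subalgebraD(2)[OF A1]] E0R[OF E1A[OF tA1]] E1t by simp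
    also have "\<dots> = (of_real \<tau> * c) *\<^sub>C 1"
      unfolding c by (simp add: scaleC_scaleC flip: scaleC_of_real)
    finally have tr2: "tr (star e2 * w) = of_real \<tau> * c"
      unfolding assms(11) tower_trace_def e2 by (simp only: scalar_of_scaleC_one)
    show ?thesis unfolding eps epsNV tr1 tr2 using \<tau> by (simp add: field_simps)
  qed
qed

end
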